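(* Let $r\ge 0$ be an integer and let $F_r=F_r(L,M,D,P,\Gamma,\Delta)$ be the class of pairs $(f,\eta)$ defined in the context. There exists a constant $C$ (depending only on $L,M,P,D,r,a,b$ and on the radius $R$) such that for any nonincreasing sequence $\{\alpha(n)\}_{n=1}^\infty$ convergent to $0$ there is $\hat n$ such that for all $n\ge \hat n$, for any partition $a=t_0<t_1<\dots<t_n=b$ with $h_k:=t_{k+1}-t_k\le\alpha(n)$ for $k=0,\dots,n-1$, any vector $\vec N=[N_{-1},N_0,\dots,N_{n-1}]$ of positive integers, and any $(f,\eta)\in F_r$, the approximation $\bar l_n$ produced by the algorithm $\phi^*_{n,\vec N}$ satisfies $$\sup_{t\in[t_k,t_{k+1}]}\|z(t)-\bar l_n(t)\|\le C\Bigl(\gamma(N_{-1})+\sum_{j=0}^{k}h_j\,\delta(N_j)+\sum_{j=0}^{k}h_j^{\max\{r,1\}+1}\Bigr),\qquad k=0,1,\dots,n-1,$$ where $z$ is the solution of $z'(t)=f(z(t))$, $t\in[a,b]$, $z(a)=\eta$. Consequently, the worst-case error $e(\phi^*_{n,\vec N},\mathcal N^*_{n,\vec N},F_r):=\sup_{(f,\eta)\in F_r}\sup_{t\in[a,b]}\|z(t)-\bar l_n(t)\|$ satisfies $$e(\phi^*_{n,\vec N},\mathcal N^*_{n,\vec N},F_r)\le C\Bigl(\gamma(N_{-1})+\sum_{j=0}^{n-1}h_j\,\delta(N_j)+\sum_{j=0}^{n-1}h_j^{\max\{r,1\}+1}\Bigr),$$ and here the last sum is bounded by $\alpha(n)^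{\max\{r,1\}}(b-a)$.
   Context: **Space.** $(E,\|\cdot\|)$ is an infinite-dimensional real Banach space with a Schauder basis $\{e_1,e_2,\dots\}$, $\|e_j\|=1$. For $y=\sum_j y^je_j$ put $P_ky=\sum_{j=1}^k y^je_j$, and let $P=\sup_k\|P_k\|<\infty$ be the basis constant. Let $a<b$ be real numbers. **Algorithm $\phi^*_{n,\vec N}$.** Given an integer $r\ge0$, a Lipschitz $f:E\to E$, $\eta\in E$, a partition $a=t_0<\dots<t_n=b$ with $h_k=t_{k+1}-t_k$, and $\vec N=[N_{-1},N_0,\dots,N_{n-1}]$ with positive integer entries, let $\bar f_k=P_{N_k}f$ and $\bar y_0=P_{N_{-1}}\eta$. Suppose first $r\ge1$. For $k=0,\dots,n-1$, given $\bar y_k\in E$, put $\bar l_{k,0}(t)\equiv\bar y_k$, and for $s=0,1,\dots,r-1$ $$\bar q_{k,s}(t)=\sum_{p=0}^s\ \prod_{l=0,\,l\ne p}^s\frac{t-\xi_{k,l}}{\xi_{k,p}-\xi_{k,l}}\ \bar f_k(\bar l_{k,s}(\xi_{k,p})),\qquad \bar l_{k,s+1}(t)=\bar y_k+\int_{t_k}^t\bar q_{k,s}(\xi)\,d\xi,\quad t\in[t_k,t_{k+1}],$$ where $\xi_{k,p}=t_k+ph_k/s$, $p=0,\dots,s$ (for $s=0$: $\xi_{k,0}=t_k$ and the empty product is $1$). Put $\bar y_{k+1}=\bar l_{k,r}(t_{k+1})$ and $\bar l_n(t)=\bar l_{k,r}(t)$ for $t\in[t_k,t_{k+1}]$. For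 $r=0$, $\bar l_n$ is defined as for $r=1$, i.e. $\bar l_n(t)=\bar y_k+(t-t_k)\bar f_k(\bar y_k)$ on $[t_k,t_{k+1}]$ and $\bar y_{k+1}=\bar l_n(t_{k+1})$. The information about $(f,\eta)$ used is denoted $\mathcal N^*_{n,\vec N}(f,\eta)$, and the output of $\phi^*_{n,\vec N}$ is the function $\bar l_n:[a,b]\to E$. Let $\bar z_k:[t_k,t_{k+1}]\to E$ be the solution of the local problem $\bar z_k'(t)=\bar f_k(\bar z_k(t))$, $\bar z_k(t_k)=\bar y_k$. **Class $F_r$.** Let $L,M,D>0$ and let $\Gamma=\{\gamma(k)\}_{k\ge1}$, $\Delta=\{\delta(k)\}_{k\ge1}$ be positive, nonincreasing sequences convergent to zero. Consider pairs $(f,\eta)$, $f:E\to E$, $\eta\in E$, with (A1) $\|\eta-P_k\eta\|\le\gamma(k)$ for $k\in\mathbb N$; (A2) $\|f(y)-f(\bar y)\|\le L\|y-\bar y\|$ for $y,\bar y\in E$; (A3) $\|f(\eta)\|\le M$. $R$ denotes a fixed number, depending only on $L,M,\gamma(1),P,a,b$, with the following properties (such a number exists): for every $(f,\eta)$ satisfying (A1)–(A3), the solution $z$ of $z'=f(z)$, $z(a)=\eta$, satisfies $\|z(t)-\eta\|\le R$ on $[a,b]$; and for every nonincreasing $\{\alpha(n)\}$ convergent to $0$ there is $\hat n$ such that for all $n\ge\hat n$, all partitions with $\max_k h_k\le\alpha(n)$, all $\vec N$ and all $(f,\eta)$ satisfying (A1)–(A3), $\|\bar z_k(t)-\eta\|\le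 R$ for $t\in[t_k,t_{k+1}]$, $k=0,\dots,n-1$. Put $K=K(\eta,R)=\{y\in E:\|y-\eta\|\le R\}$. The class $F_r$ consists of all pairs $(f,\eta)$ satisfying (A1)–(A3) and (A4) $f\in C^r(K)$ (Fréchet derivatives) and $\sup_{y\in K}\|f^{(l)}(y)\|\le D$ for $l=1,\dots,r$ (operator norm of $l$-linear maps); (A5) $\sup_{y\in K}\|f(y)-P_kf(y)\|\le\delta(k)$ for $k\in\mathbb N$. *)

theory Defs
  imports "HOL-Analysis.Analysis"
begin

(* The basis is indexed from 0: "e j" is the (j+1)-st basis vector, so that basis_proj e k keeps
   the first k coordinates.  Uniqueness of the expansions makes e an infinite linearly independent
   family; a space with such a basis is infinite-dimensional. *)

definition schauder_basis :: "(nat \<Rightarrow> 'e::real_normed_vector) \<Rightarrow> bool" where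
  "schauder_basis e \<longleftrightarrow> (\<forall>y. \<exists>!c. (\<lambda>j. c j *\<^sub>R e j) sums y)"

definition basis_coeff :: "(nat \<Rightarrow> 'e::real_normed_vector) \<Rightarrow> 'e \<Rightarrow> nat \<Rightarrow> real" where
  "basis_coeff e y = (THE c. (\<lambda>j. c j *\<^sub>R e j) sums y)"

definition basis_proj :: "(nat \<Rightarrow> 'e::real_normed_vector) \<Rightarrow> nat \<Rightarrow> 'e \<Rightarrow> 'e" where
  "basis_proj e k y = (\<Sum>j<k. basis_coeff e y j *\<^sub>R e j)"

(* The first two conjuncts say that the supremum of the operator norms is finite; in a Banach space
   they hold for every Schauder basis.  They are spelled out because onorm and the real-valued
   supremum are unspecified on unbounded data. *)

definition has_basis_constant :: "(nat \<Rightarrow> 'e::real_normed_vector) \<Rightarrow> real \<Rightarrow> bool" where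
  "has_basis_constant e P \<longleftrightarrow>
     (\<forall>k\<ge>1. bounded_linear (basis_proj e k)) \<and>
     bdd_above ((\<lambda>k. onorm (basis_proj e k)) ` {1..}) \<and>
     P = (SUP k\<in>{1..}. onorm (basis_proj e k))"

(* Sequences are indexed from 1; the value at 0 is never used. *)

definition nonincr_null :: "(nat \<Rightarrow> real) \<Rightarrow> bool" where
  "nonincr_null s \<longleftrightarrow> (\<forall>j k. 1 \<le> j \<and> j \<le> k \<longrightarrow> s k \<le> s j) \<and> s \<longlonglongrightarrow> 0"

definition pos_nonincr_null :: "(nat \<Rightarrow> real) \<Rightarrow> bool" where
  "pos_nonincr_null s \<longleftrightarrow> (\<forall>k\<ge>1. 0 < s k) \<and> nonincr_null s"

definition ivp_solution ::
  "('e::real_normed_vector \<Rightarrow> 'e) \<Rightarrow> real \<Rightarrow> real \<Rightarrow> 'e \<Rightarrow> (real \<Rightarrow> 'e) \<Rightarrow> bool" where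
  "ivp_solution g t0 t1 y0 z \<longleftrightarrow>
     z t0 = y0 \<and>
     (\<forall>t\<in>{t0..t1}. (z has_vector_derivative g (z t)) (at t within {t0..t1}))"

(* For Lipschitz g the solution exists and is unique on {t0..t1}; outside that interval the chosen
   function is arbitrary and never evaluated. *)

definition ivp_sol :: "('e::real_normed_vector \<Rightarrow> 'e) \<Rightarrow> real \<Rightarrow> real \<Rightarrow> 'e \<Rightarrow> real \<Rightarrow> 'e" where
  "ivp_sol g t0 t1 y0 = (SOME z. ivp_solution g t0 t1 y0 z)"

(* For s = 0 the only node is p = 0 and division by zero yields tk, as required. *)

definition node :: "real \<Rightarrow> real \<Rightarrow> nat \<Rightarrow> nat \<Rightarrow> real" where
  "node tk h s p = tk + real p * h / real s"

definition interp ::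
  "('e::real_normed_vector \<Rightarrow> 'e) \<Rightarrow> real \<Rightarrow> real \<Rightarrow> nat \<Rightarrow> (real \<Rightarrow> 'e) \<Rightarrow> real \<Rightarrow> 'e" where
  "interp g tk h s l t =
     (\<Sum>p\<in>{0..s}.
        (\<Prod>i\<in>{0..s} - {p}. (t - node tk h s i) / (node tk h s p - node tk h s i)) *\<^sub>R
          g (l (node tk h s p)))"

primrec local_approx ::
  "('e::banach \<Rightarrow> 'e) \<Rightarrow> real \<Rightarrow> real \<Rightarrow> 'e \<Rightarrow> nat \<Rightarrow> real \<Rightarrow> 'e" where
  "local_approx g tk h y 0 = (\<lambda>t. y)"
| "local_approx g tk h y (Suc s) =
     (\<lambda>t. y + integral {tk..t} (interp g tk h s (local_approx g tk h y s)))"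

definition fbar ::
  "(nat \<Rightarrow> 'e::banach) \<Rightarrow> ('e \<Rightarrow> 'e) \<Rightarrow> (int \<Rightarrow> nat) \<Rightarrow> nat \<Rightarrow> 'e \<Rightarrow> 'e" where
  "fbar e f N k y = basis_proj e (N (int k)) (f y)"

(* N is indexed by the integers -1, 0, ..., n - 1.  For r = 0 the algorithm is that of r = 1. *)

primrec ybar ::
  "(nat \<Rightarrow> 'e::banach) \<Rightarrow> nat \<Rightarrow> ('e \<Rightarrow> 'e) \<Rightarrow> 'e \<Rightarrow> (nat \<Rightarrow> real) \<Rightarrow> (int \<Rightarrow> nat) \<Rightarrow> nat \<Rightarrow> 'e" where
  "ybar e r f \<eta> t N 0 = basis_proj e (N (-1)) \<eta>"
| "ybar e r f \<eta> t N (Suc k) =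
     local_approx (fbar e f N k) (t k) (t (Suc k) - t k) (ybar e r f \<eta> t N k) (max r 1) (t (Suc k))"

(* At an interior grid point the two adjacent pieces agree, so it does not matter that LEAST
   selects the left one. *)

definition lbar ::
  "(nat \<Rightarrow> 'e::banach) \<Rightarrow> nat \<Rightarrow> ('e \<Rightarrow> 'e) \<Rightarrow> 'e \<Rightarrow> (nat \<Rightarrow> real) \<Rightarrow> (int \<Rightarrow> nat) \<Rightarrow> real \<Rightarrow> 'e" where
  "lbar e r f \<eta> t N s =
     (let k = (LEAST k. s \<le> t (Suc k)) in
        local_approx (fbar e f N k) (t k) (t (Suc k) - t k) (ybar e r f \<eta> t N k) (max r 1) s)"

definition grid :: "real \<Rightarrow> real \<Rightarrow> nat \<Rightarrow> (nat \<Rightarrow> real) \<Rightarrow> bool" where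
  "grid a b n t \<longleftrightarrow> t 0 = a \<and> t n = b \<and> (\<forall>k<n. t k < t (Suc k))"

definition admissible_run ::
  "real \<Rightarrow> real \<Rightarrow> (nat \<Rightarrow> real) \<Rightarrow> nat \<Rightarrow> (nat \<Rightarrow> real) \<Rightarrow> (int \<Rightarrow> nat) \<Rightarrow> bool" where
  "admissible_run a b \<alpha> n t N \<longleftrightarrow>
     grid a b n t \<and> (\<forall>k<n. t (Suc k) - t k \<le> \<alpha> n) \<and> (\<forall>j\<in>{-1..<int n}. 1 \<le> N j)"

(* An l-linear map is a function on argument lists of length l; its values on other lists are
   irrelevant. *)

definition bounded_multilinear ::
  "nat \<Rightarrow> ('e::real_normed_vector list \<Rightarrow> 'f::real_normed_vector) \<Rightarrow> bool" where
  "bounded_multilinear l A \<longleftrightarrow>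
     (\<forall>vs. length vs = l \<longrightarrow> (\<forall>i<l. linear (\<lambda>v. A (vs[i := v])))) \<and>
     (\<exists>B. \<forall>vs. length vs = l \<longrightarrow> norm (A vs) \<le> B * prod_list (map norm vs))"

definition multilinear_norm ::
  "nat \<Rightarrow> ('e::real_normed_vector list \<Rightarrow> 'f::real_normed_vector) \<Rightarrow> real" where
  "multilinear_norm l A =
     (SUP vs\<in>{vs. length vs = l \<and> (\<forall>v\<in>set vs. norm v \<le> 1)}. norm (A vs))"

(* "F l y" is the l-th derivative of f at y: F (Suc l) is the derivative of F l in operator norm,
   the direction of differentiation being the first argument.  Derivatives are taken relative to
   K; when K is a ball of positive radius they are uniquely determined by f, also at boundary
   points.  The last conjunct is continuity in operator norm. *)

definition has_derivs_on ::
  "('e::real_normed_vector \<Rightarrow> 'e) \<Rightarrow> (nat \<Rightarrow> 'e \<Rightarrow> 'e list \<Rightarrow> 'e) \<Rightarrow> nat \<Rightarrow> 'e set \<Rightarrow> bool" where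
  "has_derivs_on f F r K \<longleftrightarrow>
     (\<forall>y\<in>K. F 0 y [] = f y) \<and>
     (\<forall>l\<le>r. \<forall>y\<in>K. bounded_multilinear l (F l y)) \<and>
     (\<forall>l<r. \<forall>y\<in>K.
        ((\<lambda>x. multilinear_norm l (\<lambda>vs. F l x vs - F l y vs - F (Suc l) y ((x - y) # vs))
               / norm (x - y)) \<longlongrightarrow> 0) (at y within K)) \<and>
     (\<forall>l\<le>r. \<forall>y\<in>K.
        ((\<lambda>x. multilinear_norm l (\<lambda>vs. F l x vs - F l y vs)) \<longlongrightarrow> 0) (at y within K))"

definition basic_class ::
  "(nat \<Rightarrow> 'e::banach) \<Rightarrow> real \<Rightarrow> real \<Rightarrow> (nat \<Rightarrow> real) \<Rightarrow> (('e \<Rightarrow> 'e) \<times> 'e) set" where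
  "basic_class e L M \<gamma> = {(f, \<eta>).
     (\<forall>k\<ge>1. norm (\<eta> - basis_proj e k \<eta>) \<le> \<gamma> k) \<and>
     (\<forall>y y'. norm (f y - f y') \<le> L * norm (y - y')) \<and>
     norm (f \<eta>) \<le> M}"

definition problem_class ::
  "nat \<Rightarrow> (nat \<Rightarrow> 'e::banach) \<Rightarrow> real \<Rightarrow> real \<Rightarrow> real \<Rightarrow> (nat \<Rightarrow> real) \<Rightarrow> (nat \<Rightarrow> real) \<Rightarrow> real \<Rightarrow>
     (('e \<Rightarrow> 'e) \<times> 'e) set" where
  "problem_class r e L M D \<gamma> \<delta> R = {(f, \<eta>).
     (f, \<eta>) \<in> basic_class e L M \<gamma> \<and>
     (\<exists>F. has_derivs_on f F r (cball \<eta> R) \<and>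
          (\<forall>l\<in>{1..r}. \<forall>y\<in>cball \<eta> R. multilinear_norm l (F l y) \<le> D)) \<and>
     (\<forall>k\<ge>1. \<forall>y\<in>cball \<eta> R. norm (f y - basis_proj e k (f y)) \<le> \<delta> k)}"

(* The properties that fix the radius R: exact solutions, and for fine grids all solutions of the
   local problems, stay in the ball of radius R about the initial value. *)

definition good_radius ::
  "nat \<Rightarrow> (nat \<Rightarrow> 'e::banach) \<Rightarrow> real \<Rightarrow> real \<Rightarrow> (nat \<Rightarrow> real) \<Rightarrow> real \<Rightarrow> real \<Rightarrow> real \<Rightarrow> bool" where
  "good_radius r e L M \<gamma> a b R \<longleftrightarrow>
     (\<forall>(f, \<eta>)\<in>basic_class e L M \<gamma>. \<forall>z. ivp_solution f a b \<eta> z \<longrightarrow>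
        (\<forall>s\<in>{a..b}. norm (z s - \<eta>) \<le> R)) \<and>
     (\<forall>\<alpha>. nonincr_null \<alpha> \<longrightarrow>
        (\<exists>n0. \<forall>n\<ge>n0. \<forall>t N. admissible_run a b \<alpha> n t N \<longrightarrow>
          (\<forall>(f, \<eta>)\<in>basic_class e L M \<gamma>. \<forall>k<n. \<forall>z.
             ivp_solution (fbar e f N k) (t k) (t (Suc k)) (ybar e r f \<eta> t N k) z \<longrightarrow>
             (\<forall>s\<in>{t k..t (Suc k)}. norm (z s - \<eta>) \<le> R))))"

definition worst_case_error ::
  "nat \<Rightarrow> (nat \<Rightarrow> 'e::banach) \<Rightarrow> real \<Rightarrow> real \<Rightarrow> (nat \<Rightarrow> real) \<Rightarrow> (int \<Rightarrow> nat) \<Rightarrow>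
     (('e \<Rightarrow> 'e) \<times> 'e) set \<Rightarrow> ereal" where
  "worst_case_error r e a b t N \<F> =
     (SUP (f, \<eta>)\<in>\<F>. SUP s\<in>{a..b}. ereal (norm (ivp_sol f a b \<eta> s - lbar e r f \<eta> t N s)))"

end

theory Submission
  imports Defs
begin

text \<open>
Each step of the method is a Picard iteration in which the right-hand side is replaced by its
interpolating polynomial. The error is measured against the exact solution $z$, which stays in the
ball $K$ where smoothness and truncation error are controlled; the numerical values enter only
through the global Lipschitz condition, by
$\|P_N f(y) - f(z)\| \le P L \|y - z\| + \delta(N)$
(\<open>projected_field_near\<close>).

Within one step, let $E_s$ be the error of the $s$-th iterate and $e$ the error at the start of the step.
Integration over a step of length $h$ gives
$E_{s+1} \le e + h\,(A (E_s + \delta) + I h^{s+1})$, where $I h^{s+1}$ accounts for the interpolation of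
$z' = f \circ z$ by polynomials of degree $s$. By induction
$E_s \le e + c h (e + \delta) + c h^{s+1}$ (\<open>local_approx_error\<close>). Applied at the end of
each step, this is a recursion for the errors at the grid points, which the discrete Gronwall inequality
solves (\<open>discrete_gronwall\<close>, \<open>run_error\<close>).

The interpolation error needs a bound for the derivatives of $z'$ that depends only on the constants
of the class. Differentiating $f \circ z$ repeatedly along $z' = f(z)$ produces sums of elementary
differentials, indexed by rooted trees, and one differentiation grafts a leaf in all possible ways
(\<open>elem_diff_along_solution\<close>). A tree with $m$ vertices contributes at most $B^m$. Since
values are in a Banach space, the interpolation error is obtained from Taylor's formula with integral
remainder and from the fact that interpolation reproduces polynomials
(\<open>perturbed_interpolation_error\<close>).

For the worst-case error, existence of the exact solutions is shown by a contraction argument in a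
weighted supremum norm (\<open>ivp_solution_exists\<close>).
\<close>

section \<open>Existence of solutions\<close>

text \<open>The worst-case error refers to a chosen solution of each problem, so a solution has to exist.
A solution $z$ is sought as $z(s) = e^{2L(s-a)} u(s)$ with $u$ in the Banach space of bounded
continuous functions: with this weight the Picard operator becomes a contraction with factor
$1/2$ on the whole interval, however long it is, because
$\int_a^s L e^{2L(\tau-a)}\,d\tau \le e^{2L(s-a)}/2$.\<close>

lemma ivp_solution_exists:
  fixes g :: "'e::banach \<Rightarrow> 'e"
  assumes lip: "\<And>x y. norm (g x - g y) \<le> L * norm (x - y)" and "0 < L" and "a \<le> b"
  shows "\<exists>z. ivp_solution g a b y0 z"
proof -
  define W where "W u s = exp (2 * L * (s - a)) *\<^sub>R apply_bcontfun u s" for u :: "real \<Rightarrow>\<^sub>C 'e" and s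
  define S where "S u s = exp (- (2 * L * (s - a))) *\<^sub>R (y0 + integral {a..s} (\<lambda>\<tau>. g (W u \<tau>)))"
    for u s
  have "continuous_on UNIV g"
    by (rule continuous_on_subset[OF lipschitz_on_continuous_on[of L UNIV g]])
      (use lip \<open>0 < L\<close> in \<open>auto simp: lipschitz_on_def dist_norm\<close>)
  then have cont: "continuous_on A (\<lambda>\<tau>. g (W u \<tau>))" for u A
    unfolding W_def
    by (intro continuous_on_compose2[of UNIV g A] continuous_intros continuous_on_apply_bcontfun) auto
  have deriv: "((\<lambda>s. integral {a..s} (\<lambda>\<tau>. g (W u \<tau>))) has_vector_derivative g (W u s))
      (at s within {a..b})" if "s \<in> {a..b}" for u s
    by (rule integral_has_vector_derivative[OF cont that])
  have contS: "continuous_on (cbox a b) (S u)" for u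
  proof -
    have "continuous_on {a..b} (\<lambda>s. integral {a..s} (\<lambda>\<tau>. g (W u \<tau>)))"
      using deriv has_vector_derivative_continuous
      by (metis continuous_on_eq_continuous_within)
    then show ?thesis
      unfolding S_def cbox_interval by (intro continuous_intros)
  qed
  \<comment> \<open>A bounded continuous function lives on all of $\mathbb{R}$, so the Picard image is continued by its boundary values.\<close>
  have "\<exists>v. \<forall>s. apply_bcontfun v s = S u (clamp a b s)" for u
    using continuous_on_cbox_bcontfunE[OF contS[of u]] by metis
  then obtain T where T: "\<And>u s. apply_bcontfun (T u) s = S u (clamp a b s)"
    by metis
  have S_bound: "norm (S u s - S v s) \<le> 1 / 2 * dist u v" if s: "s \<in> {a..b}" for u v s
  proof -
    have diff: "S u s - S v s = exp (- (2 * L * (s - a))) *\<^sub>R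
        integral {a..s} (\<lambda>\<tau>. g (W u \<tau>) - g (W v \<tau>))"
      unfolding S_def
      by (subst integral_diff)
        (auto intro: integrable_continuous_real cont simp: scaleR_diff_right[symmetric])
    have prim: "((\<lambda>\<tau>. L * exp (2 * L * (\<tau> - a)) * dist u v) has_integral
        exp (2 * L * (s - a)) / 2 * dist u v - exp (2 * L * (a - a)) / 2 * dist u v) {a..s}"
      by (rule fundamental_theorem_of_calculus)
        (use s in \<open>auto intro!: derivative_eq_intros
            simp: has_real_derivative_iff_has_vector_derivative[symmetric]\<close>)
    have "norm (integral {a..s} (\<lambda>\<tau>. g (W u \<tau>) - g (W v \<tau>))) \<le>
        integral {a..s} (\<lambda>\<tau>. L * exp (2 * L * (\<tau> - a)) * dist u v)"
    proof (rule integral_norm_bound_integral)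
      show "(\<lambda>\<tau>. g (W u \<tau>) - g (W v \<tau>)) integrable_on {a..s}"
        by (intro integrable_continuous_real continuous_on_diff cont)
      show "(\<lambda>\<tau>. L * exp (2 * L * (\<tau> - a)) * dist u v) integrable_on {a..s}"
        using prim by blast
      fix \<tau> assume "\<tau> \<in> {a..s}"
      have "norm (W u \<tau> - W v \<tau>) = exp (2 * L * (\<tau> - a)) * dist (u \<tau>) (v \<tau>)"
        by (simp add: W_def scaleR_diff_right[symmetric] dist_norm)
      also have "\<dots> \<le> exp (2 * L * (\<tau> - a)) * dist u v"
        by (intro mult_left_mono dist_bounded) auto
      finally have "L * norm (W u \<tau> - W v \<tau>) \<le> L * (exp (2 * L * (\<tau> - a)) * dist u v)"
        using \<open>0 < L\<close> by simp
      with lip[of "W u \<tau>" "W v \<tau>"]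
      show "norm (g (W u \<tau>) - g (W v \<tau>)) \<le> L * exp (2 * L * (\<tau> - a)) * dist u v"
        by (simp add: mult.assoc)
    qed
    also have "\<dots> \<le> exp (2 * L * (s - a)) / 2 * dist u v"
      using integral_unique[OF prim] by simp
    finally have "norm (S u s - S v s) \<le>
        exp (- (2 * L * (s - a))) * (exp (2 * L * (s - a)) / 2 * dist u v)"
      unfolding diff by simp
    also have "\<dots> = (exp (- (2 * L * (s - a))) * exp (2 * L * (s - a))) * (1 / 2 * dist u v)"
      by simp
    also have "\<dots> = 1 / 2 * dist u v"
      by (simp add: exp_minus)
    finally show ?thesis .
  qed
  have "\<exists>!u. T u = u"
  proof (rule banach_fix_type[of "1 / 2"])
    show "\<forall>u v. dist (T u) (T v) \<le> 1 / 2 * dist u v"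
    proof (intro allI dist_bound)
      fix u v s
      have "clamp a b s \<in> {a..b}"
        using clamp_in_interval[of a b s] \<open>a \<le> b\<close> by (simp add: cbox_interval)
      then show "dist (T u s) (T v s) \<le> 1 / 2 * dist u v"
        unfolding T dist_norm[of "S u _"] by (rule S_bound)
    qed
  qed auto
  then obtain u where u: "T u = u" by blast
  define z where "z s = y0 + integral {a..s} (\<lambda>\<tau>. g (W u \<tau>))" for s
  have zW: "z s = W u s" if "s \<in> {a..b}" for s
  proof -
    have "apply_bcontfun u s = S u s"
      using T[of u s] u that by (simp add: cbox_interval)
    then show ?thesis
      by (simp add: W_def S_def z_def exp_minus)
  qed
  have "(z has_vector_derivative g (z s)) (at s within {a..b})" if "s \<in> {a..b}" for s
  proof -
    have "((\<lambda>s. y0 + integral {a..s} (\<lambda>\<tau>. g (W u \<tau>))) has_vector_derivative 0 + g (W u s))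
        (at s within {a..b})"
      by (intro has_vector_derivative_add has_vector_derivative_const deriv that)
    then have "(z has_vector_derivative g (W u s)) (at s within {a..b})"
      by (simp add: z_def[abs_def])
    then show ?thesis
      by (simp add: zW[OF that])
  qed
  then have "ivp_solution g a b y0 z"
    unfolding ivp_solution_def by (simp add: z_def)
  then show ?thesis
    by blast
qed

section \<open>Bounded multilinear maps along curves\<close>

lemma prod_list_in_unit_interval:
  assumes "\<And>v. v \<in> set vs \<Longrightarrow> 0 \<le> f v \<and> f v \<le> (1::real)"
  shows "0 \<le> prod_list (map f vs) \<and> prod_list (map f vs) \<le> 1"
  using assms by (induction vs) (auto intro!: mult_le_one)

lemma multilinear_update:
  "bounded_multilinear l A \<Longrightarrow> length vs = l \<Longrightarrow> i < l \<Longrightarrow> linear (\<lambda>v. A (vs[i := v]))"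
  unfolding bounded_multilinear_def by blast

lemma bounded_multilinear_slot:
  assumes "bounded_multilinear l A" "length vs + length ws + 1 = l"
  shows "linear (\<lambda>v. A (vs @ v # ws))"
proof -
  have "linear (\<lambda>v. A ((vs @ 0 # ws)[length vs := v]))"
    using assms(2) by (intro multilinear_update[OF assms(1)]) auto
  then show ?thesis by simp
qed

text \<open>The supremum defining the multilinear norm is only meaningful once the values on unit vectors are
known to be bounded.\<close>

lemma bounded_multilinear_bdd:
  assumes "bounded_multilinear l A"
  shows "bdd_above ((\<lambda>vs. norm (A vs)) ` {vs. length vs = l \<and> (\<forall>v\<in>set vs. norm v \<le> 1)})"
proof -
  obtain B where B: "\<And>vs. length vs = l \<Longrightarrow> norm (A vs) \<le> B * prod_list (map norm vs)"
    using assms unfolding bounded_multilinear_def by blast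
  have "norm (A vs) \<le> \<bar>B\<bar>" if "length vs = l" "\<forall>v\<in>set vs. norm v \<le> 1" for vs
  proof -
    have "0 \<le> prod_list (map norm vs) \<and> prod_list (map norm vs) \<le> 1"
      using that by (intro prod_list_in_unit_interval) auto
    then have "B * prod_list (map norm vs) \<le> \<bar>B\<bar> * 1"
      by (intro mult_mono) auto
    then show ?thesis using B[OF that(1)] by simp
  qed
  then show ?thesis by (intro bdd_aboveI2[of _ _ "\<bar>B\<bar>"]) auto
qed

lemma multilinear_zero_slot:
  assumes "bounded_multilinear l A" "length vs = l" "0 \<in> set vs"
  shows "A vs = 0"
proof -
  obtain us ws where vs: "vs = us @ 0 # ws" using assms(3) by (meson split_list)
  show ?thesis
    using linear_0[OF bounded_multilinear_slot[OF assms(1), of us ws]] assms(2) vs by simp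
qed

lemma multilinear_scale:
  assumes "bounded_multilinear l A" "length us + length vs = l"
  shows "A (us @ map (\<lambda>v. c v *\<^sub>R v) vs) = prod_list (map c vs) *\<^sub>R A (us @ vs)"
  using assms(2)
proof (induction vs arbitrary: us)
  case (Cons v vs)
  have "A (us @ map (\<lambda>v. c v *\<^sub>R v) (v # vs)) = A ((us @ [c v *\<^sub>R v]) @ map (\<lambda>v. c v *\<^sub>R v) vs)"
    by simp
  also have "\<dots> = prod_list (map c vs) *\<^sub>R A (us @ (c v *\<^sub>R v) # vs)"
    using Cons by (subst Cons.IH) auto
  also have "A (us @ (c v *\<^sub>R v) # vs) = c v *\<^sub>R A (us @ v # vs)"
    using linear_scale[OF bounded_multilinear_slot[OF assms(1), of us vs]] Cons.prems by simp
  finally show ?case by (simp add: mult.commute)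
qed simp

text \<open>Homogeneity in every slot reduces the estimate to unit vectors; a zero entry, which cannot be
normalised, annihilates the form.\<close>

lemma norm_le_multilinear_norm:
  assumes A: "bounded_multilinear l A" and vs: "length vs = l"
  shows "norm (A vs) \<le> multilinear_norm l A * prod_list (map norm vs)"
proof (cases "0 \<in> set vs")
  case True
  then have "prod_list (map norm vs) = 0" by (force simp: prod_list_zero_iff)
  then show ?thesis using multilinear_zero_slot[OF A vs True] by simp
next
  case False
  let ?us = "map (\<lambda>v. (1 / norm v) *\<^sub>R v) vs"
  have "vs = map (\<lambda>v. norm v *\<^sub>R ((1 / norm v) *\<^sub>R v)) vs"
    using False by (intro nth_equalityI) (auto simp: in_set_conv_nth)
  have eq: "prod_list (map norm vs) *\<^sub>R A ?us = A vs"
  proof -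
    have "A ?us = prod_list (map (\<lambda>v. 1 / norm v) vs) *\<^sub>R A vs"
      using multilinear_scale[OF A, of "[]" vs "\<lambda>v. 1 / norm v"] vs by simp
    moreover have "prod_list (map norm vs) * prod_list (map (\<lambda>v. 1 / norm v) vs) = 1"
      using False by (induction vs) auto
    ultimately show ?thesis by simp
  qed
  have "norm (A ?us) \<le> multilinear_norm l A"
    unfolding multilinear_norm_def
    using vs by (intro cSUP_upper bounded_multilinear_bdd[OF A]) auto
  then have "prod_list (map norm vs) * norm (A ?us) \<le> prod_list (map norm vs) * multilinear_norm l A"
    by (intro mult_left_mono prod_list_nonneg) auto
  moreover have "norm (A vs) = prod_list (map norm vs) * norm (A ?us)"
  proof -
    have "0 \<le> prod_list (map norm vs)" by (intro prod_list_nonneg) auto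
    then show ?thesis by (subst eq[symmetric]) simp
  qed
  ultimately show ?thesis by (simp add: mult.commute)
qed

lemma bounded_multilinear_diff:
  assumes "bounded_multilinear l A" "bounded_multilinear l A'"
  shows "bounded_multilinear l (\<lambda>vs. A vs - A' vs)"
proof -
  obtain B B' where B: "\<And>vs. length vs = l \<Longrightarrow> norm (A vs) \<le> B * prod_list (map norm vs)"
      "\<And>vs. length vs = l \<Longrightarrow> norm (A' vs) \<le> B' * prod_list (map norm vs)"
    using assms unfolding bounded_multilinear_def by blast
  have "norm (A vs - A' vs) \<le> (B + B') * prod_list (map norm vs)" if "length vs = l" for vs
    using norm_triangle_ineq4[of "A vs" "A' vs"] B[OF that] by (simp add: algebra_simps)
  then show ?thesis
    using assms unfolding bounded_multilinear_def by (auto intro!: linear_compose_sub)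
qed

lemma bounded_multilinear_Cons:
  assumes "bounded_multilinear (Suc l) A"
  shows "bounded_multilinear l (\<lambda>vs. A (v # vs))"
proof -
  obtain B where B: "\<And>vs. length vs = Suc l \<Longrightarrow> norm (A vs) \<le> B * prod_list (map norm vs)"
    using assms unfolding bounded_multilinear_def by blast
  have "linear (\<lambda>u. A (v # vs[i := u]))" if "length vs = l" "i < l" for vs i
  proof -
    have "linear (\<lambda>u. A ((v # vs)[Suc i := u]))"
      using that by (intro multilinear_update[OF assms]) auto
    then show ?thesis by simp
  qed
  moreover have "norm (A (v # vs)) \<le> (B * norm v) * prod_list (map norm vs)" if "length vs = l" for vs
    using B[of "v # vs"] that by (simp add: mult.assoc)
  ultimately show ?thesis unfolding bounded_multilinear_def by blast
qed

text \<open>Passing from one argument list to the other one slot at a time turns a difference of values into a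
sum of terms that are linear in a single increment. Both the continuity of multilinear maps and
their product rule come from this identity.\<close>

lemma multilinear_telescope:
  assumes A: "bounded_multilinear l A" and len: "length us = l" "length vs = l"
  shows "A us - A vs = (\<Sum>i<l. A (take i us @ (us ! i - vs ! i) # drop (Suc i) vs))"
proof -
  have "A (take i us @ (us ! i - vs ! i) # drop (Suc i) vs)
      = A (take (Suc i) us @ drop (Suc i) vs) - A (take i us @ drop i vs)" if "i < l" for i
  proof -
    have "drop i vs = vs ! i # drop (Suc i) vs" using that len by (simp add: Cons_nth_drop_Suc)
    then show ?thesis
      using that len
        linear_diff[OF bounded_multilinear_slot[OF A, of "take i us" "drop (Suc i) vs"], of "us ! i" "vs ! i"]
      by (simp add: take_Suc_conv_app_nth)
  qed
  then have "(\<Sum>i<l. A (take i us @ (us ! i - vs ! i) # drop (Suc i) vs))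
      = (\<Sum>i<l. A (take (Suc i) us @ drop (Suc i) vs) - A (take i us @ drop i vs))"
    by (intro sum.cong) auto
  also have "\<dots> = A us - A vs" using len by (subst sum_lessThan_telescope) simp
  finally show ?thesis by simp
qed

lemma tendsto_prod_list:
  fixes f :: "'i \<Rightarrow> 'b \<Rightarrow> real"
  assumes "\<And>i. i \<in> set is \<Longrightarrow> ((f i) \<longlongrightarrow> g i) F"
  shows "((\<lambda>t. prod_list (map (\<lambda>i. f i t) is)) \<longlongrightarrow> prod_list (map g is)) F"
  using assms by (induction "is") (auto intro!: tendsto_mult)

lemma multilinear_tendsto:
  assumes A: "bounded_multilinear l A"
    and us: "\<And>i. i < l \<Longrightarrow> (us i \<longlongrightarrow> vs i) F"
  shows "((\<lambda>t. A (map (\<lambda>i. us i t) [0..<l])) \<longlongrightarrow> A (map vs [0..<l])) F"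
proof -
  let ?u = "\<lambda>t. map (\<lambda>i. us i t) [0..<l]" and ?v = "map vs [0..<l]"
  obtain B where B: "\<And>vs. length vs = l \<Longrightarrow> norm (A vs) \<le> B * prod_list (map norm vs)"
    using A unfolding bounded_multilinear_def by blast
  have "((\<lambda>t. A (take i (?u t) @ (?u t ! i - ?v ! i) # drop (Suc i) ?v)) \<longlongrightarrow> 0) F" if i: "i < l" for i
  proof (rule tendsto_norm_zero_cancel, rule Lim_null_comparison)
    \<comment> \<open>By boundedness the $i$-th telescope term is at most $B$ times a product with one factor tending to $0$.\<close>
    let ?a = "\<lambda>t. B * (prod_list (map (\<lambda>j. norm (us j t)) [0..<i]) * (norm (us i t - vs i) *
        prod_list (map norm (drop (Suc i) ?v))))"
    have "((\<lambda>t. prod_list (map (\<lambda>j. norm (us j t)) [0..<i])) \<longlongrightarrow>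
        prod_list (map (\<lambda>j. norm (vs j)) [0..<i])) F"
      using us i by (intro tendsto_prod_list tendsto_norm) auto
    moreover have "((\<lambda>t. norm (us i t - vs i)) \<longlongrightarrow> 0) F"
      using us[OF i] LIM_zero tendsto_norm_zero by blast
    ultimately have "(?a \<longlongrightarrow> B * (prod_list (map (\<lambda>j. norm (vs j)) [0..<i]) *
        (0 * prod_list (map norm (drop (Suc i) ?v))))) F"
      by (intro tendsto_mult tendsto_const)
    then show "(?a \<longlongrightarrow> 0) F" by simp
    have "norm (A (take i (?u t) @ (?u t ! i - ?v ! i) # drop (Suc i) ?v)) \<le> ?a t" for t
      using B[of "take i (?u t) @ (?u t ! i - ?v ! i) # drop (Suc i) ?v"] i
      by (simp add: take_map o_def)
    then show "\<forall>\<^sub>F t in F. norm (norm (A (take i (?u t) @ (?u t ! i - ?v ! i) # drop (Suc i) ?v))) \<le> ?a t"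
      by simp
  qed
  then have "((\<lambda>t. A (?u t) - A ?v) \<longlongrightarrow> (\<Sum>i<l. 0)) F"
    by (subst multilinear_telescope[OF A]) (simp, simp, intro tendsto_sum, simp only: lessThan_iff)
  then show ?thesis by (simp add: LIM_zero_iff)
qed

lemma has_vector_derivative_iff_quotient:
  fixes f :: "real \<Rightarrow> 'e::real_normed_vector"
  shows "(f has_vector_derivative D) (at t within S) \<longleftrightarrow>
    ((\<lambda>\<tau>. inverse (\<tau> - t) *\<^sub>R (f \<tau> - f t)) \<longlongrightarrow> D) (at t within S)"
proof -
  have "norm (f \<tau> - f t - (\<tau> - t) *\<^sub>R D) / norm (\<tau> - t)
      = norm (inverse (\<tau> - t) *\<^sub>R (f \<tau> - f t) - D)" if "\<tau> \<noteq> t" for \<tau>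
  proof -
    have "inverse (\<tau> - t) *\<^sub>R (f \<tau> - f t) - D = inverse (\<tau> - t) *\<^sub>R (f \<tau> - f t - (\<tau> - t) *\<^sub>R D)"
      using that by (simp add: scaleR_diff_right)
    then show ?thesis by (simp add: divide_inverse mult.commute)
  qed
  then have "((\<lambda>\<tau>. norm (f \<tau> - f t - (\<tau> - t) *\<^sub>R D) / norm (\<tau> - t)) \<longlongrightarrow> 0) (at t within S) \<longleftrightarrow>
      ((\<lambda>\<tau>. norm (inverse (\<tau> - t) *\<^sub>R (f \<tau> - f t) - D)) \<longlongrightarrow> 0) (at t within S)"
    by (intro filterlim_cong) (auto simp: eventually_at_filter)
  then show ?thesis
    unfolding has_vector_derivative_def has_derivative_iff_norm
    by (simp add: bounded_linear_scaleR_left tendsto_norm_zero_iff LIM_zero_iff)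
qed

text \<open>The chain and product rule for $\tau \mapsto F_l(z(\tau))[u_0(\tau),\dots,u_{l-1}(\tau)]$. The
difference quotient splits exactly into three parts: the remainder of the Frechet expansion of
$F_l$ at $z(t)$, which is of order $o(\|z(\tau)-z(t)\|)$ in multilinear norm; the derivative
$F_{l+1}$ applied to the quotient of $z$; and the telescoped increments of the arguments.\<close>

lemma derivative_multilinear_along_curve:
  fixes z :: "real \<Rightarrow> 'e::real_normed_vector"
  assumes F: "has_derivs_on f F r K" and l: "l < r"
    and t: "t \<in> S" and zK: "\<And>\<tau>. \<tau> \<in> S \<Longrightarrow> z \<tau> \<in> K"
    and dz: "(z has_vector_derivative z') (at t within S)"
    and du: "\<And>i. i < l \<Longrightarrow> (u i has_vector_derivative u' i) (at t within S)"
  defines "us \<equiv> \<lambda>\<tau>. map (\<lambda>i. u i \<tau>) [0..<l]"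
  shows "((\<lambda>\<tau>. F l (z \<tau>) (us \<tau>)) has_vector_derivative
      F (Suc l) (z t) (z' # us t) + (\<Sum>i<l. F l (z t) ((us t)[i := u' i]))) (at t within S)"
proof -
  let ?at = "at t within S"
  define y where "y = z t"
  define c where "c \<tau> = inverse (\<tau> - t)" for \<tau>
  define \<rho> where "\<rho> x = multilinear_norm l (\<lambda>vs. F l x vs - F l y vs - F (Suc l) y ((x - y) # vs))
      / norm (x - y)" for x
  define R where "R \<tau> = F l (z \<tau>) (us \<tau>) - F l y (us \<tau>) - F (Suc l) y ((z \<tau> - y) # us \<tau>)" for \<tau>
  have yK: "y \<in> K" unfolding y_def using zK[OF t] .
  have bm: "bounded_multilinear k (F k x)" if "k \<le> r" "x \<in> K" for k x
    using F that unfolding has_derivs_on_def by blast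
  have bm_l: "bounded_multilinear l (F l y)" and bm_Suc: "bounded_multilinear (Suc l) (F (Suc l) y)"
    using bm yK l by auto
  have qz: "((\<lambda>\<tau>. c \<tau> *\<^sub>R (z \<tau> - y)) \<longlongrightarrow> z') ?at"
    using dz unfolding has_vector_derivative_iff_quotient c_def y_def .
  have qu: "((\<lambda>\<tau>. c \<tau> *\<^sub>R (u i \<tau> - u i t)) \<longlongrightarrow> u' i) ?at" if "i < l" for i
    using du[OF that] unfolding has_vector_derivative_iff_quotient c_def .
  have cont_z: "(z \<longlongrightarrow> y) ?at"
    unfolding y_def using has_vector_derivative_continuous[OF dz] by (simp add: continuous_within)
  have cont_u: "(u i \<longlongrightarrow> u i t) ?at" if "i < l" for i
    using has_vector_derivative_continuous[OF du[OF that]] by (simp add: continuous_within)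

  \<comment> \<open>The Frechet remainder.\<close>
  have "((\<lambda>\<tau>. c \<tau> *\<^sub>R R \<tau>) \<longlongrightarrow> 0) ?at"
  proof (rule Lim_null_comparison)
    \<comment> \<open>Division by zero gives $\rho(y) = 0$, so the differentiability limit reads as continuity of $\rho$ at $y$; it can then be composed with $z$, which may return to $y$.\<close>
    have "continuous (at y within K) \<rho>"
      using F yK l unfolding has_derivs_on_def continuous_within \<rho>_def by auto
    then have "((\<lambda>\<tau>. \<rho> (z \<tau>)) \<longlongrightarrow> \<rho> y) ?at"
      by (rule continuous_within_tendsto_compose)
        (use zK cont_z in \<open>auto simp: eventually_at_filter\<close>)
    moreover have "((\<lambda>\<tau>. prod_list (map (\<lambda>i. norm (u i \<tau>)) [0..<l])) \<longlongrightarrow>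
        prod_list (map (\<lambda>i. norm (u i t)) [0..<l])) ?at"
      using cont_u by (intro tendsto_prod_list tendsto_norm) auto
    ultimately have "((\<lambda>\<tau>. \<rho> (z \<tau>) * norm (c \<tau> *\<^sub>R (z \<tau> - y)) *
        prod_list (map (\<lambda>i. norm (u i \<tau>)) [0..<l])) \<longlongrightarrow>
        \<rho> y * norm z' * prod_list (map (\<lambda>i. norm (u i t)) [0..<l])) ?at"
      by (intro tendsto_mult tendsto_norm qz)
    then show "((\<lambda>\<tau>. \<rho> (z \<tau>) * norm (c \<tau> *\<^sub>R (z \<tau> - y)) *
        prod_list (map (\<lambda>i. norm (u i \<tau>)) [0..<l])) \<longlongrightarrow> 0) ?at"
      by (simp add: \<rho>_def)
    have "norm (c \<tau> *\<^sub>R R \<tau>) \<le> \<rho> (z \<tau>) * norm (c \<tau> *\<^sub>R (z \<tau> - y)) *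
        prod_list (map (\<lambda>i. norm (u i \<tau>)) [0..<l])" if "\<tau> \<in> S" for \<tau>
    proof (cases "z \<tau> = y")
      case True
      then have "R \<tau> = 0"
        using multilinear_zero_slot[OF bm_Suc, of "0 # us \<tau>"] by (simp add: R_def us_def)
      then show ?thesis using True by simp
    next
      case False
      have "bounded_multilinear l (\<lambda>vs. F l (z \<tau>) vs - F l y vs - F (Suc l) y ((z \<tau> - y) # vs))"
        using bm zK[OF that] yK l by (intro bounded_multilinear_diff bounded_multilinear_Cons) auto
      from norm_le_multilinear_norm[OF this, of "us \<tau>"]
      have "norm (R \<tau>) \<le> \<rho> (z \<tau>) * norm (z \<tau> - y) * prod_list (map (\<lambda>i. norm (u i \<tau>)) [0..<l])"
        using False by (simp add: R_def \<rho>_def us_def o_def)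
      then have "\<bar>c \<tau>\<bar> * norm (R \<tau>) \<le> \<bar>c \<tau>\<bar> * (\<rho> (z \<tau>) * norm (z \<tau> - y) *
          prod_list (map (\<lambda>i. norm (u i \<tau>)) [0..<l]))"
        by (intro mult_left_mono) auto
      then show ?thesis by (simp add: mult_ac)
    qed
    then show "\<forall>\<^sub>F \<tau> in ?at. norm (c \<tau> *\<^sub>R R \<tau>) \<le> \<rho> (z \<tau>) * norm (c \<tau> *\<^sub>R (z \<tau> - y)) *
        prod_list (map (\<lambda>i. norm (u i \<tau>)) [0..<l])"
      by (auto simp: eventually_at_filter)
  qed
  \<comment> \<open>The motion of the base point.\<close>
  moreover have "((\<lambda>\<tau>. F (Suc l) y ((c \<tau> *\<^sub>R (z \<tau> - y)) # us \<tau>)) \<longlongrightarrow> F (Suc l) y (z' # us t)) ?at"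
  proof -
    have "((\<lambda>\<tau>. F (Suc l) y (map (\<lambda>i. (case i of 0 \<Rightarrow> \<lambda>\<tau>. c \<tau> *\<^sub>R (z \<tau> - y) | Suc j \<Rightarrow> u j) \<tau>) [0..<Suc l]))
        \<longlongrightarrow> F (Suc l) y (map (\<lambda>i. case i of 0 \<Rightarrow> z' | Suc j \<Rightarrow> u j t) [0..<Suc l])) ?at"
      by (rule multilinear_tendsto[OF bm_Suc]) (use qz cont_u in \<open>auto split: nat.split\<close>)
    then show ?thesis
      by (simp add: us_def upt_conv_Cons map_Suc_upt[symmetric] o_def del: upt_Suc)
  qed
  \<comment> \<open>The motion of the arguments: slots below $i$ already moved, slots above $i$ not yet.\<close>
  moreover have "((\<lambda>\<tau>. \<Sum>i<l. F l y (take i (us \<tau>) @ (c \<tau> *\<^sub>R (u i \<tau> - u i t)) # drop (Suc i) (us t)))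
      \<longlongrightarrow> (\<Sum>i<l. F l y ((us t)[i := u' i]))) ?at"
  proof (rule tendsto_sum)
    fix i assume "i \<in> {..<l}"
    then have i: "i < l" by simp
    have 1: "map (\<lambda>j. if j < i then u j \<tau> else if j = i then c \<tau> *\<^sub>R (u i \<tau> - u i t) else u j t) [0..<l]
        = take i (us \<tau>) @ (c \<tau> *\<^sub>R (u i \<tau> - u i t)) # drop (Suc i) (us t)" for \<tau>
      using i by (intro nth_equalityI) (auto simp: us_def nth_append nth_Cons')
    have 2: "map (\<lambda>j. if j < i then u j t else if j = i then u' i else u j t) [0..<l] = (us t)[i := u' i]"
      using i by (intro nth_equalityI) (auto simp: us_def nth_list_update)
    have "((\<lambda>\<tau>. F l y (map (\<lambda>j. if j < i then u j \<tau> else if j = i then c \<tau> *\<^sub>R (u i \<tau> - u i t) else u j t) [0..<l]))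
        \<longlongrightarrow> F l y (map (\<lambda>j. if j < i then u j t else if j = i then u' i else u j t) [0..<l])) ?at"
      by (rule multilinear_tendsto[OF bm_l]) (use qu cont_u i in auto)
    then show "((\<lambda>\<tau>. F l y (take i (us \<tau>) @ (c \<tau> *\<^sub>R (u i \<tau> - u i t)) # drop (Suc i) (us t)))
      \<longlongrightarrow> F l y ((us t)[i := u' i])) ?at"
      unfolding 1 2 .
  qed
  ultimately have lim: "((\<lambda>\<tau>. c \<tau> *\<^sub>R R \<tau> + F (Suc l) y ((c \<tau> *\<^sub>R (z \<tau> - y)) # us \<tau>) +
        (\<Sum>i<l. F l y (take i (us \<tau>) @ (c \<tau> *\<^sub>R (u i \<tau> - u i t)) # drop (Suc i) (us t))))
      \<longlongrightarrow> 0 + F (Suc l) y (z' # us t) + (\<Sum>i<l. F l y ((us t)[i := u' i]))) ?at"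
    by (intro tendsto_add)
  have "c \<tau> *\<^sub>R (F l (z \<tau>) (us \<tau>) - F l y (us t)) = c \<tau> *\<^sub>R R \<tau> +
      F (Suc l) y ((c \<tau> *\<^sub>R (z \<tau> - y)) # us \<tau>) +
      (\<Sum>i<l. F l y (take i (us \<tau>) @ (c \<tau> *\<^sub>R (u i \<tau> - u i t)) # drop (Suc i) (us t)))" for \<tau>
  proof -
    have 1: "F (Suc l) y ((c \<tau> *\<^sub>R (z \<tau> - y)) # us \<tau>) = c \<tau> *\<^sub>R F (Suc l) y ((z \<tau> - y) # us \<tau>)"
      using linear_scale[OF bounded_multilinear_slot[OF bm_Suc, of "[]" "us \<tau>"]] by (simp add: us_def)
    have "F l y (take i (us \<tau>) @ (c \<tau> *\<^sub>R (u i \<tau> - u i t)) # drop (Suc i) (us t))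
        = c \<tau> *\<^sub>R F l y (take i (us \<tau>) @ (us \<tau> ! i - us t ! i) # drop (Suc i) (us t))" if "i < l" for i
      using linear_scale[OF bounded_multilinear_slot[OF bm_l, of "take i (us \<tau>)" "drop (Suc i) (us t)"]] that
      by (simp add: us_def)
    then have 2: "(\<Sum>i<l. F l y (take i (us \<tau>) @ (c \<tau> *\<^sub>R (u i \<tau> - u i t)) # drop (Suc i) (us t)))
        = c \<tau> *\<^sub>R (F l y (us \<tau>) - F l y (us t))"
      by (subst multilinear_telescope[OF bm_l]) (auto simp: us_def scaleR_sum_right)
    show ?thesis unfolding 1 2 R_def by (simp add: scaleR_diff_right)
  qed
  then show ?thesis
    unfolding has_vector_derivative_iff_quotient using lim by (simp add: c_def y_def)
qed

section \<open>Derivatives along a solution and rooted trees\<close>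

datatype rtree = Node "rtree list"

primrec nodes :: "rtree \<Rightarrow> nat" where
  "nodes (Node ts) = Suc (sum_list (map nodes ts))"

text \<open>The elementary differential of Butcher: a vertex with $l$ children contributes the derivative of
order $l$ at $y$, applied to the elementary differentials of the children. The one-vertex tree
gives $f(y)$.\<close>

primrec elem_diff :: "(nat \<Rightarrow> 'e \<Rightarrow> 'e list \<Rightarrow> 'e) \<Rightarrow> 'e \<Rightarrow> rtree \<Rightarrow> 'e" where
  "elem_diff F y (Node ts) = F (length ts) y (map (elem_diff F y) ts)"

text \<open>Termination of the recursion into subtrees selected by their index.\<close>

lemma size_nth_rtree [termination_simp]: "i < length ts \<Longrightarrow> size (ts ! i) < Suc (size_list size ts)"
  for ts :: "rtree list"
  using size_list_estimation'[of "ts ! i" ts "size (ts ! i)" size] by simp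

text \<open>All ways of attaching a new leaf to a vertex of the tree: the first tree attaches it to the root,
the others to a vertex of one of the subtrees.\<close>

fun graft :: "rtree \<Rightarrow> rtree list" where
  "graft (Node ts) = Node (Node [] # ts) #
     concat (map (\<lambda>i. map (\<lambda>T. Node (ts[i := T])) (graft (ts ! i))) [0..<length ts])"

text \<open>The trees obtained from the single vertex by $j$ graftings, listed with multiplicity; their
elementary differentials sum to the derivative of order $j$ of $f \circ z$.\<close>

primrec rtrees :: "nat \<Rightarrow> rtree list" where
  "rtrees 0 = [Node []]"
| "rtrees (Suc j) = concat (map graft (rtrees j))"

lemma nodes_pos: "0 < nodes T"
  by (cases T) simp

lemma length_le_sum_nodes: "length ts \<le> sum_list (map nodes ts)"
proof (induction ts)
  case (Cons T ts)
  then show ?case using nodes_pos[of T] by simp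
qed simp

lemma nodes_graft: "T' \<in> set (graft T) \<Longrightarrow> nodes T' = Suc (nodes T)"
proof (induction T arbitrary: T')
  case (Node ts)
  show ?case
  proof (cases "T' = Node (Node [] # ts)")
    case False
    then have "\<exists>i<length ts. \<exists>T''\<in>set (graft (ts ! i)). T' = Node (ts[i := T''])"
      using Node.prems by auto
    then obtain i T'' where i: "i < length ts" and T'': "T'' \<in> set (graft (ts ! i))"
      and T': "T' = Node (ts[i := T''])"
      by blast
    have "nodes T'' = Suc (nodes (ts ! i))"
      using Node.IH[of "ts ! i" T''] i T'' by simp
    moreover have "nodes (ts ! i) \<le> sum_list (map nodes ts)"
      using i by (intro member_le_sum_list) auto
    ultimately show ?thesis
      using i by (simp add: T' map_update sum_list_update)
  qed simp
qed

lemma nodes_rtrees: "T \<in> set (rtrees j) \<Longrightarrow> nodes T = Suc j"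
  by (induction j arbitrary: T) (auto dest: nodes_graft)

lemma sum_list_concat_map:
  "sum_list (map f (concat (map g xs))) = sum_list (map (\<lambda>x. sum_list (map f (g x))) xs)"
  for f :: "'b \<Rightarrow> 'c::monoid_add"
  by (induction xs) auto

lemma linear_sum_list: "linear g \<Longrightarrow> g (sum_list (map h xs)) = sum_list (map (\<lambda>x. g (h x)) xs)"
  by (induction xs) (auto simp: linear_add linear_0)

text \<open>Attaching a leaf to the root inserts $f(y)$ as an additional argument; attaching it inside the
$i$-th subtree changes the $i$-th argument only, and by linearity in that slot the sum can be moved
inside. The right-hand side is exactly what the product rule produces.\<close>

lemma elem_diff_graft:
  assumes "bounded_multilinear (length ts) (F (length ts) y)"
  shows "sum_list (map (elem_diff F y) (graft (Node ts))) =
    F (Suc (length ts)) y (F 0 y [] # map (elem_diff F y) ts) +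
    (\<Sum>i<length ts. F (length ts) y
      ((map (elem_diff F y) ts)[i := sum_list (map (elem_diff F y) (graft (ts ! i)))]))"
proof -
  have "sum_list (map (\<lambda>T. elem_diff F y (Node (ts[i := T]))) (graft (ts ! i)))
      = F (length ts) y ((map (elem_diff F y) ts)[i := sum_list (map (elem_diff F y) (graft (ts ! i)))])"
    if "i < length ts" for i
    using that by (subst linear_sum_list[OF multilinear_update[OF assms]]) (auto simp: map_update)
  then have "sum_list (map (\<lambda>i. sum_list (map (\<lambda>T. elem_diff F y (Node (ts[i := T]))) (graft (ts ! i))))
        [0..<length ts])
      = (\<Sum>i<length ts. F (length ts) y
          ((map (elem_diff F y) ts)[i := sum_list (map (elem_diff F y) (graft (ts ! i)))]))"
    by (subst interv_sum_list_conv_sum_set_nat) (auto intro!: sum.cong simp: atLeast0LessThan)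
  then show ?thesis
    by (simp add: sum_list_concat_map o_def)
qed

text \<open>Since $z' = f(z)$, differentiating along the solution is the same as grafting a leaf. A vertex of a
tree with at most $r$ vertices has fewer than $r$ children, so the derivatives of $f$ that occur on
either side have order at most $r$.\<close>

lemma elem_diff_along_solution:
  assumes F: "has_derivs_on f F r K" and zK: "\<And>\<tau>. \<tau> \<in> S \<Longrightarrow> z \<tau> \<in> K"
    and dz: "\<And>\<tau>. \<tau> \<in> S \<Longrightarrow> (z has_vector_derivative f (z \<tau>)) (at \<tau> within S)"
    and t: "t \<in> S" and T: "nodes T \<le> r"
  shows "((\<lambda>\<tau>. elem_diff F (z \<tau>) T) has_vector_derivative
    sum_list (map (elem_diff F (z t)) (graft T))) (at t within S)"
  using T
proof (induction T)
  case (Node ts)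
  let ?l = "length ts"
  have l: "?l < r" using Node.prems length_le_sum_nodes[of ts] by simp
  have bm: "bounded_multilinear ?l (F ?l (z t))" and f: "f (z t) = F 0 (z t) []"
    using F l zK[OF t] unfolding has_derivs_on_def by auto
  have IH: "((\<lambda>\<tau>. elem_diff F (z \<tau>) (ts ! i)) has_vector_derivative
    sum_list (map (elem_diff F (z t)) (graft (ts ! i)))) (at t within S)" if "i < ?l" for i
  proof (rule Node.IH)
    show "nodes (ts ! i) \<le> r"
      using Node.prems that member_le_sum_list[of "nodes (ts ! i)" "map nodes ts"] by simp
  qed (use that in simp)
  have map: "map (\<lambda>i. elem_diff F (z \<tau>) (ts ! i)) [0..<?l] = map (elem_diff F (z \<tau>)) ts" for \<tau>
    by (rule nth_equalityI) auto
  show ?case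
    using derivative_multilinear_along_curve[OF F l t zK dz[OF t],
        where u = "\<lambda>i \<tau>. elem_diff F (z \<tau>) (ts ! i)", OF _ IH]
    unfolding map elem_diff_graft[where F = F, OF bm] f by simp
qed

text \<open>Each vertex contributes one factor $B$.\<close>

lemma elem_diff_bound:
  assumes F: "\<And>l vs. l \<le> r \<Longrightarrow> length vs = l \<Longrightarrow> norm (F l y vs) \<le> B * prod_list (map norm vs)"
    and B: "0 \<le> B" and T: "nodes T \<le> Suc r"
  shows "norm (elem_diff F y T :: 'e::real_normed_vector) \<le> B ^ nodes T"
  using T
proof (induction T)
  case (Node ts)
  have "prod_list (map (\<lambda>T. norm (elem_diff F y T)) us) \<le> B ^ sum_list (map nodes us)"
    if "set us \<subseteq> set ts" for us
    using that
  proof (induction us)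
    case (Cons T us)
    have "nodes T \<le> Suc r"
      using Node.prems Cons.prems member_le_sum_list[of "nodes T" "map nodes ts"] by auto
    then have "norm (elem_diff F y T) \<le> B ^ nodes T"
      using Node.IH Cons.prems by auto
    moreover have "0 \<le> prod_list (map (\<lambda>T. norm (elem_diff F y T)) us)"
      by (intro prod_list_nonneg) auto
    ultimately show ?case
      using Cons B by (simp add: power_add mult_mono)
  qed simp
  note prod = this[OF subset_refl]
  have "norm (elem_diff F y (Node ts)) \<le> B * prod_list (map (\<lambda>T. norm (elem_diff F y T)) ts)"
    using F[of "length ts" "map (elem_diff F y) ts"] Node.prems length_le_sum_nodes[of ts]
    by (simp add: o_def)
  also have "\<dots> \<le> B * B ^ sum_list (map nodes ts)"
    using prod B by (intro mult_left_mono)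
  finally show ?case by simp
qed

lemma taylor_polynomial_error:
  fixes w :: "real \<Rightarrow> 'e::banach"
  assumes "Df 0 = w"
    and Df: "\<And>m \<tau>. m \<le> s \<Longrightarrow> \<tau> \<in> {a..b} \<Longrightarrow>
      (Df m has_vector_derivative Df (Suc m) \<tau>) (at \<tau> within {a..b})"
    and bound: "\<And>\<tau>. \<tau> \<in> {a..b} \<Longrightarrow> norm (Df (Suc s) \<tau>) \<le> B" and B: "0 \<le> B"
    and t: "t \<in> {a..b}"
  shows "norm (w t - (\<Sum>j\<le>s. (t - a) ^ j *\<^sub>R ((1 / fact j) *\<^sub>R Df j a))) \<le> B * (b - a) ^ Suc s"
proof -
  have sub: "{a..t} \<subseteq> {a..b}" and at: "a \<le> t" using t by auto
  have int: "((\<lambda>x. ((t - x) ^ (Suc s - 1) / fact (Suc s - 1)) *\<^sub>R Df (Suc s) x) has_integral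
      w t - (\<Sum>i<Suc s. ((t - a) ^ i / fact i) *\<^sub>R Df i a)) {a..t}"
    by (rule Taylor_has_integral)
      (use assms(1) at sub in \<open>auto intro!: has_vector_derivative_within_subset[OF Df sub]\<close>)
  have "norm (((t - x) ^ s / fact s) *\<^sub>R Df (Suc s) x) \<le> (b - a) ^ s * B" if "x \<in> {a..t}" for x
  proof -
    have "(t - x) ^ s / fact s \<le> (t - x) ^ s"
      using that fact_ge_1[of s, where 'a = real] by (simp add: divide_le_eq mult_le_cancel_left1)
    also have "\<dots> \<le> (b - a) ^ s" using that t by (intro power_mono) auto
    finally have "(t - x) ^ s / fact s * norm (Df (Suc s) x) \<le> (b - a) ^ s * B"
      using that sub bound t by (intro mult_mono) auto
    then show ?thesis using that by simp
  qed
  then have "norm (w t - (\<Sum>i<Suc s. ((t - a) ^ i / fact i) *\<^sub>R Df i a))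
      \<le> ((b - a) ^ s * B) * measure lborel (cbox a t)"
    using int t B by (intro has_integral_bound) (auto simp: cbox_interval)
  also have "\<dots> \<le> ((b - a) ^ s * B) * (b - a)"
    using t B by (intro mult_left_mono) auto
  finally show ?thesis
    by (simp add: lessThan_Suc_atMost mult_ac)
qed

text \<open>Along a solution the function $z' = f \circ z$ is as smooth as $f$ is on $K$: its derivative of order
$s+1 \le r$ is a sum of elementary differentials of trees with $s+2$ vertices, hence bounded by their
number times $B^{s+2}$. Taylor expansion at the left end point then gives the approximating
polynomial.\<close>

lemma solution_derivative_near_polynomial:
  fixes z :: "real \<Rightarrow> 'e::banach"
  assumes F: "has_derivs_on f F r K" and zK: "\<And>\<tau>. \<tau> \<in> {a..b} \<Longrightarrow> z \<tau> \<in> K"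
    and dz: "\<And>\<tau>. \<tau> \<in> {a..b} \<Longrightarrow> (z has_vector_derivative f (z \<tau>)) (at \<tau> within {a..b})"
    and bound: "\<And>l y vs. l \<le> r \<Longrightarrow> y \<in> K \<Longrightarrow> length vs = l \<Longrightarrow>
      norm (F l y vs) \<le> B * prod_list (map norm vs)"
    and B: "0 \<le> B" and s: "s < r"
  shows "\<exists>c. \<forall>t\<in>{a..b}. norm (f (z t) - (\<Sum>j\<le>s. (t - a) ^ j *\<^sub>R c j))
    \<le> real (length (rtrees (Suc s))) * B ^ (s + 2) * (b - a) ^ Suc s"
proof -
  \<comment> \<open>The two branches agree on $[a,b]$; the first makes $U_0$ equal to $f \circ z$ as a function on all of $\mathbb{R}$.\<close>
  define U where "U j \<tau> = (if j = 0 then f (z \<tau>) else sum_list (map (elem_diff F (z \<tau>)) (rtrees j)))"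
    for j \<tau>
  have U: "U j \<tau> = sum_list (map (elem_diff F (z \<tau>)) (rtrees j))" if "\<tau> \<in> {a..b}" for j \<tau>
    using F zK[OF that] by (auto simp: U_def has_derivs_on_def)
  have der: "((\<lambda>\<tau>. sum_list (map (elem_diff F (z \<tau>)) Ts)) has_vector_derivative
      sum_list (map (elem_diff F (z t)) (concat (map graft Ts)))) (at t within {a..b})"
    if "\<And>T. T \<in> set Ts \<Longrightarrow> nodes T \<le> r" "t \<in> {a..b}" for Ts t
    using that(1)
    by (induction Ts)
      (auto intro!: has_vector_derivative_add elem_diff_along_solution[OF F zK dz that(2)])
  have "(U j has_vector_derivative U (Suc j) t) (at t within {a..b})"
    if "j \<le> s" "t \<in> {a..b}" for j t
  proof (rule has_vector_derivative_transform[OF that(2)])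
    show "((\<lambda>\<tau>. sum_list (map (elem_diff F (z \<tau>)) (rtrees j))) has_vector_derivative U (Suc j) t)
        (at t within {a..b})"
      using der[of "rtrees j" t] that s by (simp add: U nodes_rtrees)
  qed (simp add: U)
  moreover have "norm (U (Suc s) t) \<le> real (length (rtrees (Suc s))) * B ^ (s + 2)"
    if t: "t \<in> {a..b}" for t
  proof -
    have "norm (sum_list (map (elem_diff F (z t)) Ts)) \<le> real (length Ts) * B ^ (s + 2)"
      if "\<And>T. T \<in> set Ts \<Longrightarrow> nodes T = s + 2" for Ts
      using that
    proof (induction Ts)
      case (Cons T Ts)
      have "norm (elem_diff F (z t) T) \<le> B ^ nodes T"
        using Cons.prems s by (intro elem_diff_bound[where r = r] bound zK[OF t] B) auto
      then have "norm (elem_diff F (z t) T) \<le> B ^ (s + 2)" using Cons.prems by simp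
      moreover have "norm (sum_list (map (elem_diff F (z t)) Ts)) \<le> real (length Ts) * B ^ (s + 2)"
        using Cons by simp
      ultimately show ?case
        using norm_triangle_ineq[of "elem_diff F (z t) T" "sum_list (map (elem_diff F (z t)) Ts)"]
        by (simp add: distrib_right)
    qed simp
    from this[of "rtrees (Suc s)"] show ?thesis
      unfolding U[OF t] by (simp add: nodes_rtrees del: rtrees.simps)
  qed
  moreover have "U 0 = (\<lambda>\<tau>. f (z \<tau>))" by (simp add: U_def fun_eq_iff)
  ultimately show ?thesis
    using B by (intro exI[of _ "\<lambda>j. (1 / fact j) *\<^sub>R U j a"] ballI taylor_polynomial_error) auto
qed

section \<open>Equidistant interpolation\<close>

definition lagrange_basis :: "real \<Rightarrow> real \<Rightarrow> nat \<Rightarrow> nat \<Rightarrow> real \<Rightarrow> real" where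
  "lagrange_basis tk h s p t =
     (\<Prod>i\<in>{0..s} - {p}. (t - node tk h s i) / (node tk h s p - node tk h s i))"

lemma node_in_interval:
  assumes "0 < h" "p \<le> s"
  shows "node tk h s p \<in> {tk..tk + h}"
proof -
  have "real p * h / real s \<le> h"
    using assms by (cases "s = 0") (auto simp: divide_le_eq mult.commute)
  then show ?thesis
    using assms by (simp add: node_def)
qed

lemma node_inj:
  assumes "0 < h"
  shows "inj_on (node tk h s) {0..s}"
  using assms by (auto simp: inj_on_def node_def)

lemma lagrange_basis_at_node:
  assumes "0 < h" "p \<le> s" "q \<le> s"
  shows "lagrange_basis tk h s p (node tk h s q) = (if p = q then 1 else 0)"
proof (cases "p = q")
  case True
  have "node tk h s q - node tk h s i \<noteq> 0" if "i \<in> {0..s} - {q}" for i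
    using inj_onD[OF node_inj[OF assms(1)], of tk s q i] that assms(3) by auto
  then show ?thesis
    using True unfolding lagrange_basis_def by (auto intro!: prod.neutral)
next
  case False
  then show ?thesis
    using assms unfolding lagrange_basis_def by (auto intro!: prod_zero bexI[of _ q])
qed

text \<open>For $t$ in the step, each of the $s$ factors has a numerator of size at most $h$ and a denominator of
size at least the mesh $h/s$. The bound is independent of $h$, and for $s = 0$ it is $0^0 = 1$.\<close>

lemma lagrange_basis_bound:
  assumes h: "0 < h" and p: "p \<le> s" and t: "t \<in> {tk..tk + h}"
  shows "\<bar>lagrange_basis tk h s p t\<bar> \<le> real s ^ s"
proof -
  have "\<bar>(t - node tk h s i) / (node tk h s p - node tk h s i)\<bar> \<le> real s"
    if i: "i \<in> {0..s} - {p}" for i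
  proof -
    have s: "0 < s" using i p by auto
    have num: "\<bar>t - node tk h s i\<bar> \<le> h"
      using node_in_interval[OF h, of i s tk] i t by auto
    have "1 \<le> \<bar>real p - real i\<bar>"
      using i by (cases p i rule: linorder_cases) auto
    then have "h / s \<le> \<bar>real p - real i\<bar> * (h / s)"
      using mult_right_mono[of 1 _ "h / s"] h by simp
    also have "\<dots> = \<bar>(real p - real i) * (h / s)\<bar>"
      using h by (simp add: abs_mult)
    also have "(real p - real i) * (h / s) = node tk h s p - node tk h s i"
      by (simp add: node_def algebra_simps diff_divide_distrib)
    finally have den: "h / s \<le> \<bar>node tk h s p - node tk h s i\<bar>" .
    have "\<bar>t - node tk h s i\<bar> / \<bar>node tk h s p - node tk h s i\<bar> \<le> h / (h / s)"
      using num den h s by (intro frac_le) auto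
    then show ?thesis using h by (simp add: abs_divide)
  qed
  then have "(\<Prod>i\<in>{0..s} - {p}. \<bar>(t - node tk h s i) / (node tk h s p - node tk h s i)\<bar>)
      \<le> (\<Prod>i\<in>{0..s} - {p}. real s)"
    by (intro prod_mono) auto
  also have "\<dots> = real s ^ s"
    using p by (simp add: card_Diff_singleton)
  finally show ?thesis
    by (simp add: lagrange_basis_def abs_prod)
qed

text \<open>The two sides are polynomials in $t$ of degree at most $s$ that agree at the $s+1$ nodes.\<close>

lemma lagrange_reproduces_powers:
  assumes h: "0 < h" and j: "j \<le> s"
  shows "(\<Sum>p\<in>{0..s}. lagrange_basis tk h s p t * (node tk h s p - tk) ^ j) = (t - tk) ^ j"
proof -
  let ?x = "node tk h s"
  define B where "B p = (\<Prod>i\<in>{0..s} - {p}. smult (1 / (?x p - ?x i)) [:- ?x i, 1:])" for p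
  define q where "q = (\<Sum>p\<in>{0..s}. smult ((?x p - tk) ^ j) (B p)) - [:- tk, 1:] ^ j"
  have B: "poly (B p) u = lagrange_basis tk h s p u" for p u
    by (simp add: B_def lagrange_basis_def poly_prod diff_divide_distrib)
  have q: "poly q u = (\<Sum>p\<in>{0..s}. lagrange_basis tk h s p u * (?x p - tk) ^ j) - (u - tk) ^ j" for u
    by (simp add: q_def poly_sum B mult.commute)
  have "degree (B p) \<le> s" if "p \<in> {0..s}" for p
  proof -
    have "degree (B p) \<le> (\<Sum>i\<in>{0..s} - {p}. degree (smult (1 / (?x p - ?x i)) [:- ?x i, 1:]))"
      unfolding B_def by (intro degree_prod_sum_le[unfolded o_def]) auto
    also have "\<dots> \<le> (\<Sum>i\<in>{0..s} - {p}. 1)"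
      by (intro sum_mono order.trans[OF degree_smult_le]) auto
    finally show ?thesis using that by simp
  qed
  then have "degree (\<Sum>p\<in>{0..s}. smult ((?x p - tk) ^ j) (B p)) \<le> s"
    by (intro degree_sum_le order.trans[OF degree_smult_le]) auto
  moreover have "degree ([:- tk, 1:] ^ j) \<le> s"
    using j degree_power_le[of "[:- tk, 1:]" j] by simp
  ultimately have deg: "degree q \<le> s"
    unfolding q_def by (intro degree_diff_le)
  have root: "poly q (?x p) = 0" if "p \<in> {0..s}" for p
  proof -
    have "(\<Sum>p'\<in>{0..s}. lagrange_basis tk h s p' (?x p) * (?x p' - tk) ^ j)
        = (\<Sum>p'\<in>{0..s}. if p' = p then (?x p' - tk) ^ j else 0)"
      using that h by (intro sum.cong) (auto simp: lagrange_basis_at_node)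
    then show ?thesis using that by (simp add: q)
  qed
  have "q = 0"
  proof (rule ccontr)
    assume "q \<noteq> 0"
    have "card {0..s} = card (?x ` {0..s})"
      by (rule card_image[symmetric, OF node_inj[OF h]])
    also have "\<dots> \<le> card {u. poly q u = 0}"
      using root poly_roots_finite[OF \<open>q \<noteq> 0\<close>] by (intro card_mono) auto
    also have "\<dots> \<le> s"
      using card_poly_roots_bound[OF \<open>q \<noteq> 0\<close>] deg by simp
    finally show False by simp
  qed
  then show ?thesis using q[of t] by simp
qed

text \<open>A bound, independent of the step size, for the Lebesgue constant of interpolation at $s+1$
equidistant nodes.\<close>

definition interp_factor :: "nat \<Rightarrow> real" where
  "interp_factor s = real (Suc s) * real s ^ s"

lemma interp_factor_nonneg: "0 \<le> interp_factor s"
  by (simp add: interp_factor_def)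

text \<open>Interpolation reproduces the approximating polynomial $T$ of $w$, so only the deviations of the data
from $T$ at the nodes are amplified, by at most the Lebesgue constant. The classical
remainder formula rests on Rolle's theorem, which fails for vector-valued functions.\<close>

lemma perturbed_interpolation_error:
  fixes w :: "real \<Rightarrow> 'e::real_normed_vector"
  assumes h: "0 < h" and t: "t \<in> {tk..tk + h}"
    and poly: "\<And>\<tau>. \<tau> \<in> {tk..tk + h} \<Longrightarrow> norm (w \<tau> - (\<Sum>j\<le>s. (\<tau> - tk) ^ j *\<^sub>R c j)) \<le> \<epsilon>"
    and data: "\<And>p. p \<le> s \<Longrightarrow> norm (v p - w (node tk h s p)) \<le> d"
  shows "norm ((\<Sum>p\<in>{0..s}. lagrange_basis tk h s p t *\<^sub>R v p) - w t)
    \<le> interp_factor s * (d + \<epsilon>) + \<epsilon>"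
proof -
  let ?b = "\<lambda>p. lagrange_basis tk h s p t" and ?x = "node tk h s"
  define T where "T \<tau> = (\<Sum>j\<le>s. (\<tau> - tk) ^ j *\<^sub>R c j)" for \<tau>
  have "(\<Sum>p\<in>{0..s}. ?b p *\<^sub>R T (?x p)) = (\<Sum>j\<le>s. (\<Sum>p\<in>{0..s}. ?b p * (?x p - tk) ^ j) *\<^sub>R c j)"
    unfolding T_def scaleR_sum_right scaleR_sum_left scaleR_scaleR by (rule sum.swap)
  also have "\<dots> = T t"
    unfolding T_def by (intro sum.cong) (simp_all add: lagrange_reproduces_powers[OF h])
  finally have rep: "(\<Sum>p\<in>{0..s}. ?b p *\<^sub>R T (?x p)) = T t" .
  have each: "norm (?b p *\<^sub>R (v p - T (?x p))) \<le> real s ^ s * (d + \<epsilon>)" if "p \<in> {0..s}" for p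
  proof -
    have "norm (v p - T (?x p)) \<le> norm (v p - w (?x p)) + norm (w (?x p) - T (?x p))"
      by (metis norm_triangle_ineq diff_add_cancel add_diff_eq)
    also have "\<dots> \<le> d + \<epsilon>"
      using that data poly[OF node_in_interval[OF h]] by (intro add_mono) (auto simp: T_def)
    finally show ?thesis
      using that lagrange_basis_bound[OF h _ t, of p s] by (auto intro!: mult_mono)
  qed
  have "norm (\<Sum>p\<in>{0..s}. ?b p *\<^sub>R (v p - T (?x p))) \<le> (\<Sum>p\<in>{0..s}. real s ^ s * (d + \<epsilon>))"
    by (intro sum_norm_le each)
  then have 1: "norm (\<Sum>p\<in>{0..s}. ?b p *\<^sub>R (v p - T (?x p))) \<le> interp_factor s * (d + \<epsilon>)"
    by (simp add: interp_factor_def algebra_simps)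
  have "(\<Sum>p\<in>{0..s}. ?b p *\<^sub>R v p) - w t = (\<Sum>p\<in>{0..s}. ?b p *\<^sub>R (v p - T (?x p))) + (T t - w t)"
    by (simp add: scaleR_diff_right sum_subtractf rep)
  also have "norm \<dots> \<le> interp_factor s * (d + \<epsilon>) + \<epsilon>"
    using 1 poly[OF t] by (intro norm_triangle_mono) (simp_all add: T_def norm_minus_commute)
  finally show ?thesis .
qed

lemma interp_eq_lagrange:
  "interp g tk h s l t = (\<Sum>p\<in>{0..s}. lagrange_basis tk h s p t *\<^sub>R g (l (node tk h s p)))"
  by (simp add: interp_def lagrange_basis_def)

lemma continuous_on_interp: "continuous_on A (interp g tk h s l)"
  unfolding interp_eq_lagrange[abs_def] lagrange_basis_def divide_inverse
  by (intro continuous_intros)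

lemma interp_error:
  fixes z :: "real \<Rightarrow> 'e::real_normed_vector"
  assumes h: "0 < h" and t: "t \<in> {tk..tk + h}"
    and poly: "\<And>\<tau>. \<tau> \<in> {tk..tk + h} \<Longrightarrow> norm (w \<tau> - (\<Sum>j\<le>s. (\<tau> - tk) ^ j *\<^sub>R c j)) \<le> \<epsilon>"
    and g: "\<And>\<tau> y. \<tau> \<in> {tk..tk + h} \<Longrightarrow> norm (g y - w \<tau>) \<le> Q * norm (y - z \<tau>) + \<delta>" and Q: "0 \<le> Q"
    and l: "\<And>\<tau>. \<tau> \<in> {tk..tk + h} \<Longrightarrow> norm (l \<tau> - z \<tau>) \<le> E"
  shows "norm (interp g tk h s l t - w t) \<le> interp_factor s * (Q * E + \<delta> + \<epsilon>) + \<epsilon>"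
  unfolding interp_eq_lagrange
proof (rule perturbed_interpolation_error[OF h t poly])
  fix p assume "p \<le> s"
  note n = node_in_interval[OF h this, of tk]
  show "norm (g (l (node tk h s p)) - w (node tk h s p)) \<le> Q * E + \<delta>"
    using g[OF n, of "l (node tk h s p)"] mult_left_mono[OF l[OF n] Q] by simp
qed auto

section \<open>Error of one step\<close>

lemma norm_increment_le:
  fixes z :: "real \<Rightarrow> 'e::real_normed_vector"
  assumes z: "\<And>\<tau>. \<tau> \<in> {a..b} \<Longrightarrow> (z has_vector_derivative w \<tau>) (at \<tau> within {a..b})"
    and w: "\<And>\<tau>. \<tau> \<in> {a..b} \<Longrightarrow> norm (w \<tau>) \<le> B" and t: "t \<in> {a..b}"
  shows "norm (z t - z a) \<le> B * (t - a)"
proof -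
  have B: "0 \<le> B" using order_trans[OF norm_ge_zero w[OF t]] .
  have "norm (z t - z a) \<le> B * norm (t - a)"
  proof (rule differentiable_bound[of "{a..b}" z "\<lambda>\<tau> x. x *\<^sub>R w \<tau>"])
    show "onorm (\<lambda>x. x *\<^sub>R w \<tau>) \<le> B" if "\<tau> \<in> {a..b}" for \<tau>
      using w[OF that] B by (intro onorm_bound) (auto simp: mult.commute[of B] intro!: mult_left_mono)
  qed (use z t in \<open>auto simp: has_vector_derivative_def\<close>)
  then show ?thesis using t by simp
qed

text \<open>The constant of the one-step estimate after $s$ sweeps, as produced by the recursion in the proof:
$Q$ is the Lipschitz constant of the projected field, $V_s h^{s+1}$ the polynomial approximation error
of $z'$, $B$ a bound for $\|z'\|$ and $H$ a bound for the step size.\<close>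

primrec step_const :: "real \<Rightarrow> (nat \<Rightarrow> real) \<Rightarrow> real \<Rightarrow> real \<Rightarrow> nat \<Rightarrow> real" where
  "step_const Q V B H 0 = B"
| "step_const Q V B H (Suc s) =
     interp_factor s * ((Q + 1) * (1 + step_const Q V B H s * (1 + H)) + V s) + V s"

lemma step_const_nonneg:
  assumes "0 \<le> Q" "\<And>s. 0 \<le> V s" "0 \<le> B" "0 \<le> H"
  shows "0 \<le> step_const Q V B H s"
  by (induction s) (auto simp: assms interp_factor_nonneg)

text \<open>The comparison is made directly with the curve $z$, although the step starts at a different point $y$
and uses a field $g$ that approximates $z'$ only up to $\delta$. One sweep integrates the interpolant of
the previous approximation; integrating over an interval of length $h$ multiplies the previous error
and the interpolation error by $h$. Hence every sweep gains one order in $h$, while the initial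
discrepancy $E$ and the truncation error $\delta$ are amplified only by $1 + O(h)$ and $O(h)$.\<close>

lemma local_approx_error:
  fixes g :: "'e::banach \<Rightarrow> 'e" and z w :: "real \<Rightarrow> 'e" and y :: 'e
  assumes h: "0 < h" "h \<le> H" and nonneg: "0 \<le> Q" "0 \<le> \<delta>" "0 \<le> B" "\<And>s. 0 \<le> V s"
    and z: "\<And>\<tau>. \<tau> \<in> {tk..tk + h} \<Longrightarrow> (z has_vector_derivative w \<tau>) (at \<tau> within {tk..tk + h})"
    and w: "\<And>\<tau>. \<tau> \<in> {tk..tk + h} \<Longrightarrow> norm (w \<tau>) \<le> B"
    and poly: "\<And>s. s < m \<Longrightarrow> \<exists>c. \<forall>\<tau>\<in>{tk..tk + h}.
      norm (w \<tau> - (\<Sum>j\<le>s. (\<tau> - tk) ^ j *\<^sub>R c j)) \<le> V s * h ^ Suc s"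
    and g: "\<And>\<tau> y. \<tau> \<in> {tk..tk + h} \<Longrightarrow> norm (g y - w \<tau>) \<le> Q * norm (y - z \<tau>) + \<delta>"
    and s: "s \<le> m" and t: "t \<in> {tk..tk + h}"
  defines "C \<equiv> step_const Q V B H" and "E \<equiv> norm (y - z tk)"
  shows "norm (local_approx g tk h y s t - z t) \<le> E + C s * h * (E + \<delta>) + C s * h ^ Suc s"
  using s t
proof (induction s arbitrary: t)
  case (0 t)
  have "norm (z t - z tk) \<le> B * (t - tk)"
    by (rule norm_increment_le[OF z w 0(2)])
  also have "\<dots> \<le> B * h" using 0 nonneg by (intro mult_left_mono) auto
  finally have "norm (y - z t) \<le> E + B * h"
    using norm_triangle_ineq[of "y - z tk" "z tk - z t"] by (simp add: E_def norm_minus_commute)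
  moreover have "0 \<le> B * h * (E + \<delta>)" using nonneg h by (auto simp: E_def)
  ultimately show ?case by (simp add: C_def)
next
  case (Suc s t)
  let ?l = "local_approx g tk h y s"
  obtain c where "\<forall>\<tau>\<in>{tk..tk + h}.
      norm (w \<tau> - (\<Sum>j\<le>s. (\<tau> - tk) ^ j *\<^sub>R c j)) \<le> V s * h ^ Suc s"
    using poly[of s] Suc.prems by (meson Suc_le_lessD)
  note c = bspec[OF this]
  define b where "b = interp_factor s * (Q * (E + C s * h * (E + \<delta>) + C s * h ^ Suc s) + \<delta>
      + V s * h ^ Suc s) + V s * h ^ Suc s"
  have E: "0 \<le> E" and C: "0 \<le> C s" and \<Lambda>: "0 \<le> interp_factor s"
    using nonneg h by (auto simp: E_def C_def intro!: step_const_nonneg interp_factor_nonneg)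
  have q: "norm (interp g tk h s ?l \<tau> - w \<tau>) \<le> b" if "\<tau> \<in> {tk..tk + h}" for \<tau>
    unfolding b_def using Suc.prems by (intro interp_error[OF h(1) that c g nonneg(1)] Suc.IH) auto
  have b0: "0 \<le> b"
    using order_trans[OF norm_ge_zero q[of tk]] h by simp
  have sub: "{tk..t} \<subseteq> {tk..tk + h}" and tk: "tk \<le> t" using Suc.prems by auto
  \<comment> \<open>Both the new approximation and $z$ are integrals, of the interpolant and of $w$.\<close>
  have "((\<lambda>\<tau>. w \<tau>) has_integral z t - z tk) {tk..t}"
    using tk sub by (intro fundamental_theorem_of_calculus)
      (auto intro: has_vector_derivative_within_subset[OF z])
  moreover have "(interp g tk h s ?l has_integral integral {tk..t} (interp g tk h s ?l)) {tk..t}"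
    by (intro integrable_integral integrable_continuous_real continuous_on_interp)
  ultimately have "((\<lambda>\<tau>. interp g tk h s ?l \<tau> - w \<tau>) has_integral
      integral {tk..t} (interp g tk h s ?l) - (z t - z tk)) (cbox tk t)"
    unfolding cbox_interval by (intro has_integral_diff)
  then have "norm (integral {tk..t} (interp g tk h s ?l) - (z t - z tk)) \<le> b * measure lborel (cbox tk t)"
    using q sub b0 by (intro has_integral_bound) auto
  also have "\<dots> \<le> b * h" using tk Suc.prems b0 by (intro mult_left_mono) auto
  finally have "norm ((y - z tk) + (integral {tk..t} (interp g tk h s ?l) - (z t - z tk))) \<le> E + b * h"
    by (intro norm_triangle_mono) (simp_all add: E_def)
  moreover have "b * h \<le> C (Suc s) * h * (E + \<delta>) + C (Suc s) * h ^ Suc (Suc s)"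
  proof -
    let ?\<Lambda> = "interp_factor s" and ?x = "E + \<delta>" and ?y = "h ^ Suc s"
    have x: "0 \<le> ?x" and y: "0 \<le> ?y" using E nonneg h by auto
    have 1: "Q * E + \<delta> \<le> (Q + 1) * ?x"
      using E nonneg by (simp add: algebra_simps)
    have 2: "Q * (C s * h * ?x) \<le> (Q + 1) * (C s * H * ?x)"
      using x C nonneg h by (intro mult_mono mult_right_mono mult_left_mono) auto
    have 3: "Q * (C s * ?y) \<le> (Q + 1) * (C s * ?y)"
      using y C nonneg by (intro mult_right_mono) auto
    have "Q * (E + C s * h * ?x + C s * ?y) + \<delta> \<le> (Q + 1) * (1 + C s * H) * ?x + (Q + 1) * C s * ?y"
      using 1 2 3 by (simp add: algebra_simps)
    also have "\<dots> \<le> (Q + 1) * (1 + C s * (1 + H)) * ?x + (Q + 1) * (1 + C s * (1 + H)) * ?y"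
      using x y C nonneg h by (intro add_mono mult_right_mono mult_left_mono) (auto simp: algebra_simps)
    finally have 4: "Q * (E + C s * h * ?x + C s * ?y) + \<delta>
        \<le> (Q + 1) * (1 + C s * (1 + H)) * (?x + ?y)" by (simp add: algebra_simps)
    have 5: "V s * ?y \<le> V s * (?x + ?y)" using x nonneg by (intro mult_left_mono) auto
    have "b \<le> ?\<Lambda> * ((Q + 1) * (1 + C s * (1 + H)) * (?x + ?y) + V s * (?x + ?y)) + V s * (?x + ?y)"
      unfolding b_def by (rule add_mono[OF mult_left_mono[OF add_mono[OF 4 5] \<Lambda>] 5])
    also have "\<dots> = C (Suc s) * (?x + ?y)" by (simp add: C_def algebra_simps)
    finally have "b * h \<le> C (Suc s) * (?x + ?y) * h" using h by (intro mult_right_mono) auto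
    then show ?thesis by (simp add: algebra_simps)
  qed
  ultimately show ?case by (simp add: algebra_simps)
qed

section \<open>Accumulation of the errors over a grid\<close>

text \<open>The right-hand side of the recursion is bounded itself, rather than only $e_{k+1}$, because the same
quantity bounds the error at all points inside the $k$-th step. The factors $1 + c h_j$ are absorbed
into exponentials, whose exponents add up to at most $c$ times the length of the interval.\<close>

lemma discrete_gronwall:
  fixes e :: "nat \<Rightarrow> real"
  assumes nonneg: "0 \<le> c" "\<And>k. 0 \<le> e k" "\<And>k. k < n \<Longrightarrow> 0 \<le> h k" "\<And>k. k < n \<Longrightarrow> 0 \<le> d k"
      "\<And>k. k < n \<Longrightarrow> 0 \<le> q k"
    and step: "\<And>k. k < n \<Longrightarrow> e (Suc k) \<le> e k + c * h k * (e k + d k) + c * q k"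
    and k: "k < n"
  shows "e k + c * h k * (e k + d k) + c * q k
    \<le> exp (c * (\<Sum>j\<le>k. h j)) * (e 0 + c * (\<Sum>j\<le>k. h j * d j + q j))"
proof -
  define G where "G k = exp (c * (\<Sum>j<k. h j)) * (e 0 + c * (\<Sum>j<k. h j * d j + q j))" for k
  have adv: "e k + c * h k * (e k + d k) + c * q k \<le> G (Suc k)" if "e k \<le> G k" "k < n" for k
  proof -
    define S where "S = (\<Sum>j<k. h j)"
    define T where "T = e 0 + c * (\<Sum>j<k. h j * d j + q j)"
    have S: "0 \<le> S" unfolding S_def using that nonneg by (intro sum_nonneg) auto
    have r: "0 \<le> c * (h k * d k + q k)" "0 \<le> c * h k" using that nonneg by auto
    have "e k + c * h k * (e k + d k) + c * q k = (1 + c * h k) * e k + 1 * (c * (h k * d k + q k))"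
      by (simp add: algebra_simps)
    also have "\<dots> \<le> exp (c * h k) * (exp (c * S) * T) + exp (c * (S + h k)) * (c * (h k * d k + q k))"
    proof (intro add_mono mult_mono)
      show "1 + c * h k \<le> exp (c * h k)" by (rule exp_ge_add_one_self)
      show "e k \<le> exp (c * S) * T" using that by (simp add: G_def S_def T_def)
      show "1 \<le> exp (c * (S + h k))" using S that nonneg by simp
    qed (use that r nonneg in \<open>auto intro: add_nonneg_nonneg mult_nonneg_nonneg\<close>)
    also have "\<dots> = exp (c * (S + h k)) * (T + c * (h k * d k + q k))"
      by (simp add: exp_add algebra_simps)
    also have "\<dots> = G (Suc k)"
      by (simp add: G_def S_def T_def algebra_simps)
    finally show ?thesis .
  qed
  have "e k \<le> G k" if "k \<le> n" for k
    using that
  proof (induction k)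
    case 0
    then show ?case by (simp add: G_def)
  next
    case (Suc k)
    then show ?case using adv[of k] step[of k] by simp
  qed
  from adv[OF this k] k show ?thesis
    by (simp add: G_def lessThan_Suc_atMost)
qed

section \<open>The problem class\<close>

text \<open>A common bound for $\|f\|$ on the ball $K$ and for the norms of the derivatives of $f$ there.\<close>

definition curve_bound :: "real \<Rightarrow> real \<Rightarrow> real \<Rightarrow> real \<Rightarrow> real" where
  "curve_bound L M D R = max D (M + L * R)"

text \<open>For $s = 0$ the Lipschitz constant of $f \circ z$ is used; this covers the class with $r = 0$, where
$f$ need not be differentiable.\<close>

definition taylor_const :: "real \<Rightarrow> real \<Rightarrow> nat \<Rightarrow> real" where
  "taylor_const L B s = (if s = 0 then L * B else real (length (rtrees (Suc s))) * B ^ (s + 2))"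

definition one_step_const :: "nat \<Rightarrow> real \<Rightarrow> real \<Rightarrow> real \<Rightarrow> real \<Rightarrow> real \<Rightarrow> real \<Rightarrow> real" where
  "one_step_const r L M D P R H =
     (let B = curve_bound L M D R in step_const (P * L) (taylor_const L B) B H (max r 1))"

definition error_const ::
  "nat \<Rightarrow> real \<Rightarrow> real \<Rightarrow> real \<Rightarrow> real \<Rightarrow> real \<Rightarrow> real \<Rightarrow> real" where
  "error_const r L M D P R H =
     (let c = one_step_const r L M D P R H in exp (c * H) * max 1 c)"

lemma basis_proj_bounds:
  assumes "has_basis_constant e P" "1 \<le> k"
  shows "bounded_linear (basis_proj e k)" "norm (basis_proj e k x) \<le> P * norm x" "0 \<le> P"
proof -
  show bl: "bounded_linear (basis_proj e k)"
    using assms by (simp add: has_basis_constant_def)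
  have "onorm (basis_proj e k) \<le> P"
    using assms unfolding has_basis_constant_def by (auto intro: cSUP_upper)
  then show "norm (basis_proj e k x) \<le> P * norm x" "0 \<le> P"
    using onorm[OF bl, of x] onorm_pos_le[OF bl] mult_right_mono[OF _ norm_ge_zero, of _ P x]
    by (auto intro: order_trans)
qed

text \<open>The projection is applied to a difference of values, where it costs the factor $P$, while the
truncation error is only taken at the point $x$, which will lie in the ball where it is
controlled. The point $y$ is arbitrary.\<close>

lemma projected_field_near:
  assumes P: "has_basis_constant e P" and k: "1 \<le> k"
    and lip: "norm (f y - f x) \<le> L * norm (y - x)"
    and trunc: "norm (f x - basis_proj e k (f x)) \<le> \<delta>"
  shows "norm (basis_proj e k (f y) - f x) \<le> (P * L) * norm (y - x) + \<delta>"
proof -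
  have "norm (basis_proj e k (f y) - basis_proj e k (f x)) \<le> P * norm (f y - f x)"
    using basis_proj_bounds(2)[OF P k, of "f y - f x"]
    by (simp add: linear_diff[OF bounded_linear.linear[OF basis_proj_bounds(1)[OF P k]]])
  also have "\<dots> \<le> P * (L * norm (y - x))"
    using lip basis_proj_bounds(3)[OF P k] by (rule mult_left_mono)
  finally have "norm ((basis_proj e k (f y) - basis_proj e k (f x)) + (basis_proj e k (f x) - f x))
      \<le> P * (L * norm (y - x)) + \<delta>"
    using trunc by (intro norm_triangle_mono) (simp_all add: norm_minus_commute)
  then show ?thesis by simp
qed

lemma grid_mono:
  assumes "grid a b n t" "i \<le> j" "j \<le> n"
  shows "t i \<le> t j"
  using assms(2,3)
proof (induction j rule: dec_induct)
  case (step m)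
  then have "t m < t (Suc m)" using assms(1) by (simp add: grid_def)
  then show ?case using step by simp
qed simp

text \<open>The piece that the numerical solution selects for a time $s$ contains $s$ and is not later than any
other piece containing $s$. An estimate that increases with the index of the piece therefore carries over.\<close>

lemma left_piece:
  fixes t :: "nat \<Rightarrow> 'a::linorder"
  assumes s: "s \<le> t (Suc k)" "t 0 \<le> s"
  defines "j \<equiv> LEAST k. s \<le> t (Suc k)"
  shows "j \<le> k" "s \<in> {t j..t (Suc j)}"
proof -
  show "j \<le> k" unfolding j_def using s(1) by (rule Least_le)
  have "s \<le> t (Suc j)" unfolding j_def using s(1) by (rule LeastI)
  moreover have "t j \<le> s"
  proof (cases j)
    case (Suc i)
    then have "i < (LEAST k. s \<le> t (Suc k))" by (simp add: j_def)
    then have "\<not> s \<le> t (Suc i)" by (rule not_less_Least)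
    then show ?thesis using Suc by simp
  qed (use s in simp)
  ultimately show "s \<in> {t j..t (Suc j)}" by simp
qed

lemma field_bound_on_ball:
  assumes "0 < L" and f: "(f, \<eta>) \<in> problem_class r e L M D \<gamma> \<delta> R" and y: "y \<in> cball \<eta> R"
  shows "norm (f y) \<le> curve_bound L M D R"
proof -
  have M: "norm (f \<eta>) \<le> M"
    using f by (auto simp: problem_class_def basic_class_def)
  have "norm (f y - f \<eta>) \<le> L * norm (y - \<eta>)"
    using f by (auto simp: problem_class_def basic_class_def)
  also have "L * norm (y - \<eta>) \<le> L * R"
    using y \<open>0 < L\<close> by (simp add: dist_norm norm_minus_commute)
  finally show ?thesis
    using norm_triangle_sub[of "f y" "f \<eta>"] M by (simp add: curve_bound_def)
qed

lemma solution_near_polynomial: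
  fixes z :: "real \<Rightarrow> 'e::banach"
  assumes "0 < L" "0 < D" and f: "(f, \<eta>) \<in> problem_class r e L M D \<gamma> \<delta> R"
    and zK: "\<And>\<tau>. \<tau> \<in> {a..b} \<Longrightarrow> z \<tau> \<in> cball \<eta> R"
    and dz: "\<And>\<tau>. \<tau> \<in> {a..b} \<Longrightarrow> (z has_vector_derivative f (z \<tau>)) (at \<tau> within {a..b})"
    and s: "s < max r 1"
  defines "B \<equiv> curve_bound L M D R"
  shows "\<exists>c. \<forall>\<tau>\<in>{a..b}. norm (f (z \<tau>) - (\<Sum>j\<le>s. (\<tau> - a) ^ j *\<^sub>R c j))
    \<le> taylor_const L B s * (b - a) ^ Suc s"
proof -
  have lip: "\<And>x y. norm (f x - f y) \<le> L * norm (x - y)"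
    using f by (auto simp: problem_class_def basic_class_def)
  obtain F where F: "has_derivs_on f F r (cball \<eta> R)"
    and D: "\<And>l y. l \<in> {1..r} \<Longrightarrow> y \<in> cball \<eta> R \<Longrightarrow> multilinear_norm l (F l y) \<le> D"
    using f by (auto simp: problem_class_def)
  have B: "0 \<le> B" "D \<le> B" using \<open>0 < D\<close> by (auto simp: B_def curve_bound_def)
  have fB: "norm (f y) \<le> B" if "y \<in> cball \<eta> R" for y
    unfolding B_def by (rule field_bound_on_ball[OF \<open>0 < L\<close> f that])
  show ?thesis
  proof (cases "s = 0")
    case True
    have "norm (f (z \<tau>) - f (z a)) \<le> L * B * (b - a)" if \<tau>: "\<tau> \<in> {a..b}" for \<tau>
    proof -
      have "norm (z \<tau> - z a) \<le> B * (\<tau> - a)"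
        by (rule norm_increment_le[OF dz fB[OF zK] \<tau>])
      also have "\<dots> \<le> B * (b - a)" using \<tau> B by (intro mult_left_mono) auto
      finally have "L * norm (z \<tau> - z a) \<le> L * (B * (b - a))"
        using \<open>0 < L\<close> by simp
      then show ?thesis using lip[of "z \<tau>" "z a"] by simp
    qed
    then show ?thesis
      using True by (intro exI[of _ "\<lambda>_. f (z a)"]) (simp add: taylor_const_def)
  next
    case False
    have Fb: "norm (F l y vs) \<le> B * prod_list (map norm vs)"
      if l: "l \<le> r" and y: "y \<in> cball \<eta> R" and vs: "length vs = l" for l y vs
    proof (cases l)
      case 0
      then show ?thesis using F fB[OF y] y vs by (auto simp: has_derivs_on_def)
    next
      case (Suc l')
      have "bounded_multilinear l (F l y)" using F l y by (simp add: has_derivs_on_def)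
      then have "norm (F l y vs) \<le> multilinear_norm l (F l y) * prod_list (map norm vs)"
        using vs by (rule norm_le_multilinear_norm)
      also have "\<dots> \<le> B * prod_list (map norm vs)"
        using D[of l y] Suc l y B by (intro mult_right_mono prod_list_nonneg) auto
      finally show ?thesis .
    qed
    have "s < r" using s False by simp
    have eq: "taylor_const L B s = real (length (rtrees (Suc s))) * B ^ (s + 2)"
      using False by (simp only: taylor_const_def if_False)
    show ?thesis
      unfolding eq
      by (rule solution_derivative_near_polynomial[where F = F, OF F zK dz Fb B(1) \<open>s < r\<close>])
  qed
qed

text \<open>The discrepancy $e_k$ between the numerical and the exact solution at $t_k$ satisfies
$e_{k+1} \le (1 + c h_k) e_k + c (h_k \delta(N_k) + h_k^{m+1})$ with $m = \max\{r,1\}$, by the one-step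
estimate, and $e_0 \le \gamma(N_{-1})$.\<close>

lemma run_error:
  fixes z :: "real \<Rightarrow> 'e::banach"
  assumes pos: "0 < L" "0 < D" "a < b"
    and P: "has_basis_constant e P"
    and \<gamma>: "pos_nonincr_null \<gamma>" and \<delta>: "pos_nonincr_null \<delta>"
    and R: "good_radius r e L M \<gamma> a b R"
    and run: "admissible_run a b \<alpha> n t N"
    and f: "(f, \<eta>) \<in> problem_class r e L M D \<gamma> \<delta> R"
    and z: "ivp_solution f a b \<eta> z"
    and k: "k < n" and s: "s \<in> {a..t (Suc k)}"
  shows "norm (z s - lbar e r f \<eta> t N s) \<le> error_const r L M D P R (b - a) *
    (\<gamma> (N (-1)) + (\<Sum>j\<le>k. (t (Suc j) - t j) * \<delta> (N (int j)))
      + (\<Sum>j\<le>k. (t (Suc j) - t j) ^ (max r 1 + 1)))"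
proof -
  let ?m = "max r 1"
  define B where "B = curve_bound L M D R"
  define c where "c = one_step_const r L M D P R (b - a)"
  define h where "h k = t (Suc k) - t k" for k
  define d where "d k = \<delta> (N (int k))" for k
  define err where "err k = norm (ybar e r f \<eta> t N k - z (t k))" for k
  have grid: "grid a b n t" and N: "\<And>j. j \<in> {-1..<int n} \<Longrightarrow> 1 \<le> N j"
    using run by (auto simp: admissible_run_def)
  have t0: "t 0 = a" and tn: "t n = b" using grid by (auto simp: grid_def)
  have h: "0 < h k" if "k < n" for k using grid that by (simp add: grid_def h_def)
  have d: "0 < d k" if "k < n" for k using \<delta> N[of "int k"] that by (simp add: d_def pos_nonincr_null_def)
  have sub: "{t k..t (Suc k)} \<subseteq> {a..b}" if "k < n" for k
    using grid_mono[OF grid, of 0 k] grid_mono[OF grid, of "Suc k" n] that t0 tn by auto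
  have H: "h k \<le> b - a" if "k < n" for k
    using sub[OF that] h[OF that] by (auto simp: h_def)
  have basic: "(f, \<eta>) \<in> basic_class e L M \<gamma>" using f by (simp add: problem_class_def)
  have dz: "\<And>\<tau>. \<tau> \<in> {a..b} \<Longrightarrow> (z has_vector_derivative f (z \<tau>)) (at \<tau> within {a..b})"
    and z0: "z a = \<eta>" using z by (auto simp: ivp_solution_def)
  have zK: "z \<tau> \<in> cball \<eta> R" if "\<tau> \<in> {a..b}" for \<tau>
    using R basic z that unfolding good_radius_def by (fastforce simp: dist_norm norm_minus_commute)
  have PL: "0 \<le> P * L" using basis_proj_bounds(3)[OF P order_refl] pos by simp
  have B0: "0 \<le> B" using pos by (simp add: B_def curve_bound_def)
  have V0: "0 \<le> taylor_const L B s" for s using pos B0 by (simp add: taylor_const_def)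
  have c: "c = step_const (P * L) (taylor_const L B) B (b - a) ?m"
    by (simp add: c_def one_step_const_def B_def Let_def)
  have c0: "0 \<le> c" unfolding c using PL V0 B0 pos by (intro step_const_nonneg) auto

  have piece: "norm (local_approx (fbar e f N k) (t k) (h k) (ybar e r f \<eta> t N k) ?m \<tau> - z \<tau>)
      \<le> err k + c * h k * (err k + d k) + c * h k ^ Suc ?m"
    if k: "k < n" and \<tau>: "\<tau> \<in> {t k..t (Suc k)}" for k \<tau>
    unfolding err_def c
  proof (rule local_approx_error[where w = "\<lambda>\<tau>. f (z \<tau>)" and m = ?m])
    have I: "{t k..t k + h k} = {t k..t (Suc k)}" by (simp add: h_def)
    have dz': "(z has_vector_derivative f (z \<tau>)) (at \<tau> within {t k..t k + h k})"
      if "\<tau> \<in> {t k..t k + h k}" for \<tau>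
      using that sub[OF k] unfolding I by (intro has_vector_derivative_within_subset[OF dz]) auto
    then show "(z has_vector_derivative f (z \<tau>)) (at \<tau> within {t k..t k + h k})"
      if "\<tau> \<in> {t k..t k + h k}" for \<tau> using that .
    have zK': "z \<tau> \<in> cball \<eta> R" if "\<tau> \<in> {t k..t k + h k}" for \<tau>
      using zK that sub[OF k] unfolding I by auto
    show "norm (f (z \<tau>)) \<le> B" if "\<tau> \<in> {t k..t k + h k}" for \<tau>
      unfolding B_def by (rule field_bound_on_ball[OF pos(1) f zK'[OF that]])
    show "\<exists>c. \<forall>\<tau>\<in>{t k..t k + h k}. norm (f (z \<tau>) - (\<Sum>j\<le>s. (\<tau> - t k) ^ j *\<^sub>R c j))
        \<le> taylor_const L B s * h k ^ Suc s" if "s < ?m" for s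
      using solution_near_polynomial[OF pos(1,2) f zK' dz' that, folded B_def] by simp
    \<comment> \<open>The truncation error is estimated at the exact solution, which lies in $K$; the numerical value $y$ may lie outside.\<close>
    show "norm (fbar e f N k y - f (z \<tau>)) \<le> P * L * norm (y - z \<tau>) + d k"
      if "\<tau> \<in> {t k..t k + h k}" for \<tau> y
      unfolding fbar_def
    proof (rule projected_field_near[OF P])
      show Nk: "1 \<le> N (int k)" using N k by simp
      show "norm (f y - f (z \<tau>)) \<le> L * norm (y - z \<tau>)" using basic by (simp add: basic_class_def)
      show "norm (f (z \<tau>) - basis_proj e (N (int k)) (f (z \<tau>))) \<le> d k"
        using f zK'[OF that] Nk unfolding problem_class_def d_def by auto
    qed
    show "\<tau> \<in> {t k..t k + h k}" using \<tau> unfolding I .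
  qed (use h[OF k] H[OF k] d[OF k] PL B0 V0 in auto)

  have step: "err (Suc k) \<le> err k + c * h k * (err k + d k) + c * h k ^ Suc ?m" if "k < n" for k
    using piece[OF that, of "t (Suc k)"] h[OF that] by (simp add: err_def h_def)
  have err0: "err 0 \<le> \<gamma> (N (-1))"
    using basic N[of "-1"] by (simp add: err_def t0 z0 basic_class_def norm_minus_commute)

  define j where "j = (LEAST k. s \<le> t (Suc k))"
  have j: "j \<le> k" "s \<in> {t j..t (Suc j)}"
    using left_piece[of s t k] s t0 by (auto simp: j_def)
  have jn: "j < n" using j k by simp
  have sum_h: "(\<Sum>i\<le>j. h i) \<le> b - a"
    using sub[OF jn] h[OF jn] t0
    by (simp add: h_def lessThan_Suc_atMost[symmetric] sum_lessThan_telescope del: sum.lessThan_Suc)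
  define X where "X k = \<gamma> (N (-1)) + (\<Sum>i\<le>k. h i * d i) + (\<Sum>i\<le>k. h i ^ (?m + 1))" for k
  have nonneg: "0 \<le> h i * d i" "0 \<le> h i ^ (?m + 1)" if "i \<le> k" for i
    using h[of i] d[of i] that k by auto
  have S0: "0 \<le> (\<Sum>i\<le>j. h i * d i + h i ^ Suc ?m)"
    using nonneg j by (intro sum_nonneg) (auto simp del: power_Suc)
  have "norm (z s - lbar e r f \<eta> t N s) \<le> err j + c * h j * (err j + d j) + c * h j ^ Suc ?m"
    using piece[OF jn j(2)] unfolding lbar_def j_def[symmetric] Let_def h_def[symmetric]
    by (simp add: norm_minus_commute)
  also have "\<dots> \<le> exp (c * (\<Sum>i\<le>j. h i)) * (err 0 + c * (\<Sum>i\<le>j. h i * d i + h i ^ Suc ?m))"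
    by (rule discrete_gronwall[where n = n])
      (use c0 h d step jn in \<open>auto simp: err_def less_imp_le\<close>)
  also have "\<dots> \<le> exp (c * (b - a)) * (max 1 c * X j)"
  proof (intro mult_mono)
    have "err 0 \<le> max 1 c * \<gamma> (N (-1))"
      using err0 mult_right_mono[of 1 "max 1 c" "\<gamma> (N (-1))"] norm_ge_zero
      by (smt (verit) err_def max.cobounded1 mult_1)
    moreover have "c * (\<Sum>i\<le>j. h i * d i + h i ^ Suc ?m) \<le> max 1 c * (\<Sum>i\<le>j. h i * d i + h i ^ Suc ?m)"
      using S0 by (intro mult_right_mono) auto
    ultimately show "err 0 + c * (\<Sum>i\<le>j. h i * d i + h i ^ Suc ?m) \<le> max 1 c * X j"
      by (simp add: X_def sum.distrib algebra_simps)
    show "0 \<le> err 0 + c * (\<Sum>i\<le>j. h i * d i + h i ^ Suc ?m)"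
      using S0 c0 by (simp add: err_def del: power_Suc)
  qed (use sum_h c0 in \<open>auto intro: mult_left_mono\<close>)
  also have "\<dots> \<le> exp (c * (b - a)) * (max 1 c * X k)"
  proof -
    have "X j \<le> X k"
      unfolding X_def using nonneg j by (intro add_mono sum_mono2) auto
    then show ?thesis by (intro mult_left_mono) auto
  qed
  finally show ?thesis
    by (simp add: X_def h_def d_def error_const_def c_def Let_def mult.assoc)
qed

theorem theorem1:
  fixes r :: nat and L M D P a b R :: real
  assumes "L > 0" and "M > 0" and "D > 0" and "a < b"
  shows "\<exists>C::real. \<forall>(e :: nat \<Rightarrow> 'e::banach) \<gamma> \<delta>.
    schauder_basis e \<and> (\<forall>j. norm (e j) = 1) \<and> has_basis_constant e P \<and>
    pos_nonincr_null \<gamma> \<and> pos_nonincr_null \<delta> \<and> good_radius r e L M \<gamma> a b R \<longrightarrow>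
    (\<forall>\<alpha>. nonincr_null \<alpha> \<longrightarrow>
      (\<exists>n0. \<forall>n\<ge>n0. \<forall>t N. admissible_run a b \<alpha> n t N \<longrightarrow>
        (\<forall>(f, \<eta>)\<in>problem_class r e L M D \<gamma> \<delta> R. \<forall>z. ivp_solution f a b \<eta> z \<longrightarrow>
          (\<forall>k<n. (SUP s\<in>{t k..t (Suc k)}. ereal (norm (z s - lbar e r f \<eta> t N s))) \<le>
            ereal (C * (\<gamma> (N (-1)) + (\<Sum>j\<le>k. (t (Suc j) - t j) * \<delta> (N (int j)))
                        + (\<Sum>j\<le>k. (t (Suc j) - t j) ^ (max r 1 + 1)))))) \<and>
        worst_case_error r e a b t N (problem_class r e L M D \<gamma> \<delta> R) \<le>
          ereal (C * (\<gamma> (N (-1)) + (\<Sum>j<n. (t (Suc j) - t j) * \<delta> (N (int j)))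
                      + (\<Sum>j<n. (t (Suc j) - t j) ^ (max r 1 + 1)))) \<and>
        (\<Sum>j<n. (t (Suc j) - t j) ^ (max r 1 + 1)) \<le> \<alpha> n ^ max r 1 * (b - a)))"
proof (intro exI[of _ "error_const r L M D P R (b - a)"] exI[of _ 0] allI impI, elim conjE,
    intro exI[of _ 0] allI impI conjI, goal_cases)
  case (1 e \<gamma> \<delta> \<alpha> n t N)
  have hyps: "has_basis_constant e P" "pos_nonincr_null \<gamma>" "pos_nonincr_null \<delta>"
      "good_radius r e L M \<gamma> a b R"
    and run: "admissible_run a b \<alpha> n t N"
    using 1 by blast+
  have grid: "grid a b n t" using run by (simp add: admissible_run_def)
  have "{t k..t (Suc k)} \<subseteq> {a..t (Suc k)}" if "k < n" for k
    using grid_mono[OF grid, of 0 k] that grid by (auto simp: grid_def)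
  then show ?case
    using run_error[OF assms(1,3,4) hyps run]
    by (intro ballI allI impI case_prodI2 SUP_least) (simp only: ereal_less_eq(3), blast)
next
  case (2 e \<gamma> \<delta> \<alpha> n t N)
  have hyps: "has_basis_constant e P" "pos_nonincr_null \<gamma>" "pos_nonincr_null \<delta>"
      "good_radius r e L M \<gamma> a b R"
    and run: "admissible_run a b \<alpha> n t N"
    using 2 by blast+
  have t: "t n = b" and "0 < n"
    using run assms(4) by (auto simp: admissible_run_def grid_def intro: gr0I)
  then obtain m where n: "n = Suc m" by (cases n) auto
  have z: "ivp_solution f a b \<eta> (ivp_sol f a b \<eta>)"
    if "(f, \<eta>) \<in> problem_class r e L M D \<gamma> \<delta> R" for f \<eta>
    unfolding ivp_sol_def
    by (rule someI_ex[of "ivp_solution f a b \<eta>", OF ivp_solution_exists[of f L]])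
      (use that assms in \<open>auto simp: problem_class_def basic_class_def\<close>)
  \<comment> \<open>The estimate for the last piece covers the whole interval.\<close>
  have "norm (ivp_sol f a b \<eta> s - lbar e r f \<eta> t N s) \<le> error_const r L M D P R (b - a) *
      (\<gamma> (N (-1)) + (\<Sum>j<n. (t (Suc j) - t j) * \<delta> (N (int j)))
        + (\<Sum>j<n. (t (Suc j) - t j) ^ (max r 1 + 1)))"
    if "(f, \<eta>) \<in> problem_class r e L M D \<gamma> \<delta> R" "s \<in> {a..b}" for f \<eta> s
    using run_error[OF assms(1,3,4) hyps run that(1) z[OF that(1)], of m s] that(2) t
    unfolding n lessThan_Suc_atMost by simp
  then show ?case
    unfolding worst_case_error_def by (auto intro!: SUP_least simp del: power_Suc)
next
  case (3 e \<gamma> \<delta> \<alpha> n t N)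
  have t: "t 0 = a" "t n = b"
    and h: "\<And>j. j < n \<Longrightarrow> 0 \<le> t (Suc j) - t j \<and> t (Suc j) - t j \<le> \<alpha> n"
    using \<open>admissible_run a b \<alpha> n t N\<close> by (auto simp: admissible_run_def grid_def less_imp_le)
  have "(\<Sum>j<n. (t (Suc j) - t j) ^ (max r 1 + 1)) \<le> (\<Sum>j<n. \<alpha> n ^ max r 1 * (t (Suc j) - t j))"
  proof (rule sum_mono)
    fix j assume "j \<in> {..<n}"
    then have "0 \<le> t (Suc j) - t j" "t (Suc j) - t j \<le> \<alpha> n" using h by auto
    then have "(t (Suc j) - t j) ^ max r 1 * (t (Suc j) - t j) \<le> \<alpha> n ^ max r 1 * (t (Suc j) - t j)"
      by (intro mult_right_mono power_mono)
    then show "(t (Suc j) - t j) ^ (max r 1 + 1) \<le> \<alpha> n ^ max r 1 * (t (Suc j) - t j)"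
      by (simp only: power_add power_one_right)
  qed
  also have "\<dots> = \<alpha> n ^ max r 1 * (b - a)"
    by (simp only: sum_distrib_left[symmetric] sum_lessThan_telescope t)
  finally show ?case .
qed

end
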